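(* Let $\mathcal L$ be the lamplighter group, $\mathcal S$ its sea-level subgroup and $\iota\colon\mathcal S\hookrightarrow\mathcal L$ the inclusion. For every substitutive (i.e. substitutional) $\mathcal S$-shift $X$, the induced $\mathcal L$-subshift $\iota_*(X)$ is sofic.
   Context: Lamplighter group: let $\mathbb E=\mathbb Z+\frac12$. Elements of $\mathcal L=(\mathbb Z/2)\wr\mathbb Z$ are pairs $(s,n)$ with $s\colon\mathbb E\to\mathbb Z/2$ finitely supported and $n\in\mathbb Z$, with product $(t,m)(s,n)=(s+t(\cdot-n),\,m+n)$. $\mathcal S=(\mathbb Z/2)^{(\mathbb E)}=\{(s,0)\}=\mathcal H\times\mathcal V$, where $\mathcal H$ (resp. $\mathcal V$) consists of the $s$ supported on the negative (resp. positive) elements of $\mathbb E$. Identify $\mathcal S$ with $F^{(\mathbb N)}$ for $F=(\mathbb Z/2)^2$, the $i$-th coordinate ($i\ge0$) of $s$ being $(s(-\frac12-i),s(\frac12+i))$. Substitutional shifts: let $F$ be a finite group and $K=F^{(\mathbb N)}$ the group of finitely supported functions $\mathbb N\to F$, acting on $A^K$ ($A$ finite) by $(gx)(h)=x(hg)$. Write $f_{@0}\in K$ for the element with value $f$ at position $0$ and trivial elsewhere. A substitution is a map $\tau\colon A\to\mathscr P(A^F)$ (power set). It induces $\tilde\tau\colon A^K\to\mathscr P(A^K)$, $$\tilde\tau(x)=\{x' : (f_0\mapsto x'(f_0,f_1,f_2,\dots))\in\tau(x(f_1,f_2,\dots))\ \ \forall (f_1,f_2,\dots)\in K\}.$$ For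 a set $Z$ put $\tilde\tau(Z)=\bigcup_{x\in Z}\tilde\tau(x)$. Set $X_0=A^K$, $X_{n+1}=\bigcup_{f\in F}f_{@0}\tilde\tau(X_n)$, and $X_\tau=\bigcap_n X_n$. A substitutional subshift on $K$ is a set of the form $X_\tau$. Induction: for $X\subseteq A^{\mathcal S}$, $\iota_*(X)=\{y\in A^{\mathcal L}: (h\mapsto y(hg))\in X\ \forall g\in\mathcal L\}$. An SFT on $\mathcal L$ is a subset of $B^{\mathcal L}$ ($B$ finite, action $(gx)(h)=x(hg)$) defined by finitely many forbidden patterns on finite subsets of $\mathcal L$; a sofic shift is the image of an SFT under a map $B\to A$ applied at each coordinate. *)

theory Defs
  imports
    Main
    "HOL-Library.FuncSet"
    "HOL-Library.Poly_Mapping"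
    "HOL-Library.Product_Plus"
    "HOL-Library.Z2"
begin

text \<open>
  Groups are written additively, also the non-commutative ones: \<open>h * g\<close> becomes \<open>h + g\<close>.
  Finitely supported functions \<open>I \<rightarrow> F\<close> are elements of \<open>'i \<Rightarrow>\<^sub>0 'f\<close>, with pointwise operation.
  Alphabets are finite sets \<open>A\<close>, and \<open>A^G\<close> is \<open>UNIV \<rightarrow> A\<close>.
\<close>

instance bit :: finite
proof
  have "(UNIV :: bit set) = {0, 1}"
    by auto
  then show "finite (UNIV :: bit set)"
    by (metis finite.emptyI finite.insertI)
qed


subsection \<open>Shifts, subshifts of finite type, sofic shifts\<close>

definition shift :: "'g::monoid_add \<Rightarrow> ('g \<Rightarrow> 'a) \<Rightarrow> ('g \<Rightarrow> 'a)" where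
  "shift g x = (\<lambda>h. x (h + g))"

text \<open>A pattern is a partial map with finite domain.\<close>

definition pattern_over :: "'b set \<Rightarrow> ('g \<rightharpoonup> 'b) \<Rightarrow> bool" where
  "pattern_over B p \<longleftrightarrow> finite (dom p) \<and> ran p \<subseteq> B"

definition occurs_in :: "('g::group_add \<rightharpoonup> 'b) \<Rightarrow> ('g \<Rightarrow> 'b) \<Rightarrow> bool" where
  "occurs_in p x \<longleftrightarrow> (\<exists>g. \<forall>h\<in>dom p. p h = Some (shift g x h))"

definition is_sft :: "'b set \<Rightarrow> ('g::group_add \<Rightarrow> 'b) set \<Rightarrow> bool" where
  "is_sft B Y \<longleftrightarrow> finite B \<and>
     (\<exists>P. finite P \<and> (\<forall>p\<in>P. pattern_over B p) \<and>
          Y = {y \<in> UNIV \<rightarrow> B. \<forall>p\<in>P. \<not> occurs_in p y})"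

text \<open>
  The alphabet of the covering shift of finite type is taken inside \<open>nat\<close>; this is no
  restriction, as it is finite.
\<close>

definition is_sofic :: "'a set \<Rightarrow> ('g::group_add \<Rightarrow> 'a) set \<Rightarrow> bool" where
  "is_sofic A X \<longleftrightarrow>
     (\<exists>(B :: nat set) Y \<phi>. is_sft B Y \<and> \<phi> \<in> B \<rightarrow> A \<and> X = (\<lambda>y. \<phi> \<circ> y) ` Y)"


subsection \<open>Substitutional shifts\<close>

text \<open>\<open>fcons f\<^sub>0 (f\<^sub>1, f\<^sub>2, \<dots>) = (f\<^sub>0, f\<^sub>1, f\<^sub>2, \<dots>)\<close>\<close>

lift_definition fcons :: "'f::zero \<Rightarrow> (nat \<Rightarrow>\<^sub>0 'f) \<Rightarrow> (nat \<Rightarrow>\<^sub>0 'f)"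
  is "\<lambda>f k i. case i of 0 \<Rightarrow> f | Suc j \<Rightarrow> k j"
proof -
  fix f :: 'f and k :: "nat \<Rightarrow> 'f"
  assume "finite {j. k j \<noteq> 0}"
  then have "finite (insert 0 (Suc ` {j. k j \<noteq> 0}))"
    by simp
  moreover have "{i. (case i of 0 \<Rightarrow> f | Suc j \<Rightarrow> k j) \<noteq> 0} \<subseteq> insert 0 (Suc ` {j. k j \<noteq> 0})"
    by (auto simp: gr0_conv_Suc image_iff split: nat.splits) (metis not0_implies_Suc)+
  ultimately show "finite {i. (case i of 0 \<Rightarrow> f | Suc j \<Rightarrow> k j) \<noteq> 0}"
    by (rule rev_finite_subset)
qed

definition is_substitution :: "'a set \<Rightarrow> ('a \<Rightarrow> ('f \<Rightarrow> 'a) set) \<Rightarrow> bool" where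
  "is_substitution A \<tau> \<longleftrightarrow> (\<forall>a\<in>A. \<tau> a \<subseteq> UNIV \<rightarrow> A)"

definition subst_map ::
    "'a set \<Rightarrow> ('a \<Rightarrow> ('f::zero \<Rightarrow> 'a) set) \<Rightarrow> ((nat \<Rightarrow>\<^sub>0 'f) \<Rightarrow> 'a) \<Rightarrow> ((nat \<Rightarrow>\<^sub>0 'f) \<Rightarrow> 'a) set" where
  "subst_map A \<tau> x = {x' \<in> UNIV \<rightarrow> A. \<forall>k. (\<lambda>f\<^sub>0. x' (fcons f\<^sub>0 k)) \<in> \<tau> (x k)}"

primrec subst_approx ::
    "'a set \<Rightarrow> ('a \<Rightarrow> ('f::{group_add,finite} \<Rightarrow> 'a) set) \<Rightarrow> nat \<Rightarrow> ((nat \<Rightarrow>\<^sub>0 'f) \<Rightarrow> 'a) set" where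
  "subst_approx A \<tau> 0 = UNIV \<rightarrow> A"
| "subst_approx A \<tau> (Suc n) =
     (\<Union>f. shift (Poly_Mapping.single 0 f) ` (\<Union>x\<in>subst_approx A \<tau> n. subst_map A \<tau> x))"

definition subst_shift ::
    "'a set \<Rightarrow> ('a \<Rightarrow> ('f::{group_add,finite} \<Rightarrow> 'a) set) \<Rightarrow> ((nat \<Rightarrow>\<^sub>0 'f) \<Rightarrow> 'a) set" where
  "subst_shift A \<tau> = (\<Inter>n. subst_approx A \<tau> n)"

definition is_substitutional ::
    "'a set \<Rightarrow> ((nat \<Rightarrow>\<^sub>0 'f::{group_add,finite}) \<Rightarrow> 'a) set \<Rightarrow> bool" where
  "is_substitutional A X \<longleftrightarrow> finite A \<and> (\<exists>\<tau>. is_substitution A \<tau> \<and> X = subst_shift A \<tau>)"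


subsection \<open>The lamplighter group\<close>

text \<open>
  The lamp positions are the half-integers \<open>\<int> + 1/2\<close>; throughout, the integer \<open>k\<close> stands for
  the position \<open>k + 1/2\<close>. So \<open>-1/2 - i\<close> is encoded by \<open>-1 - i\<close>, and \<open>1/2 + i\<close> by \<open>i\<close>.
\<close>

type_synonym sea_level = "int \<Rightarrow>\<^sub>0 bit"

lift_definition translate :: "int \<Rightarrow> sea_level \<Rightarrow> sea_level"
  is "\<lambda>n t k. t (k - n)"
proof -
  fix n :: int and t :: "int \<Rightarrow> bit"
  assume "finite {k. t k \<noteq> 0}"
  then have "finite ((\<lambda>k. k + n) ` {k. t k \<noteq> 0})"
    by (rule finite_imageI)
  moreover have "{k. t (k - n) \<noteq> 0} \<subseteq> (\<lambda>k. k + n) ` {k. t k \<noteq> 0}"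
    by (auto intro: image_eqI[where x = "_ - n"])
  ultimately show "finite {k. t (k - n) \<noteq> 0}"
    by (rule rev_finite_subset)
qed

lemma translate_simps:
  "translate 0 t = t"
  "translate m (translate n t) = translate (m + n) t"
  "translate n 0 = 0"
  "translate n (s + t) = translate n s + translate n t"
  "translate n (- t) = - translate n t"
  by (transfer, simp add: fun_eq_iff algebra_simps)+

datatype lamplighter = Lamp (lamps: sea_level) (pos: int)

instantiation lamplighter :: group_add
begin

definition zero_lamplighter :: lamplighter where
  "0 = Lamp 0 0"

text \<open>The product \<open>(t, m)(s, n) = (s + t(\<cdot> - n), m + n)\<close>.\<close>

definition plus_lamplighter :: "lamplighter \<Rightarrow> lamplighter \<Rightarrow> lamplighter" where
  "g + h = Lamp (lamps h + translate (pos h) (lamps g)) (pos g + pos h)"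

definition uminus_lamplighter :: "lamplighter \<Rightarrow> lamplighter" where
  "- g = Lamp (- translate (- pos g) (lamps g)) (- pos g)"

definition minus_lamplighter :: "lamplighter \<Rightarrow> lamplighter \<Rightarrow> lamplighter" where
  "g - h = g + (- h :: lamplighter)"

instance
  by standard
    (simp_all add: zero_lamplighter_def plus_lamplighter_def uminus_lamplighter_def
      minus_lamplighter_def translate_simps algebra_simps)

end

definition sea_incl :: "sea_level \<Rightarrow> lamplighter" where
  "sea_incl s = Lamp s 0"

lemma sea_incl_add: "sea_incl (s + t) = sea_incl s + sea_incl t"
  by (simp add: sea_incl_def plus_lamplighter_def translate_simps algebra_simps)

lemma inj_sea_incl: "inj sea_incl"
  by (simp add: inj_def sea_incl_def)

lift_definition sea_coords :: "sea_level \<Rightarrow> (nat \<Rightarrow>\<^sub>0 bit \<times> bit)"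
  is "\<lambda>s i. (s (- 1 - int i), s (int i))"
proof -
  fix s :: "int \<Rightarrow> bit"
  assume "finite {k. s k \<noteq> 0}"
  then have "finite ((\<lambda>k. nat (- 1 - k)) ` {k. s k \<noteq> 0} \<union> nat ` {k. s k \<noteq> 0})"
    by blast
  moreover have "{i. (s (- 1 - int i), s (int i)) \<noteq> 0}
      \<subseteq> (\<lambda>k. nat (- 1 - k)) ` {k. s k \<noteq> 0} \<union> nat ` {k. s k \<noteq> 0}"
  proof
    fix i
    assume "i \<in> {i. (s (- 1 - int i), s (int i)) \<noteq> 0}"
    then have "s (- 1 - int i) \<noteq> 0 \<or> s (int i) \<noteq> 0"
      by (auto simp: zero_prod_def)
    then show "i \<in> (\<lambda>k. nat (- 1 - k)) ` {k. s k \<noteq> 0} \<union> nat ` {k. s k \<noteq> 0}"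
    proof
      assume "s (- 1 - int i) \<noteq> 0"
      then have "i \<in> (\<lambda>k. nat (- 1 - k)) ` {k. s k \<noteq> 0}"
        by (intro image_eqI[where x = "- 1 - int i"]) auto
      then show ?thesis ..
    next
      assume "s (int i) \<noteq> 0"
      then have "i \<in> nat ` {k. s k \<noteq> 0}"
        by (intro image_eqI[where x = "int i"]) auto
      then show ?thesis ..
    qed
  qed
  ultimately show "finite {i. (s (- 1 - int i), s (int i)) \<noteq> 0}"
    by (rule rev_finite_subset)
qed

lemma sea_coords_add: "sea_coords (s + t) = sea_coords s + sea_coords t"
  by transfer (simp add: fun_eq_iff)

lemma bij_sea_coords: "bij sea_coords"
proof (rule bijI)
  show "inj sea_coords"
  proof (rule injI)
    fix s t
    assume "sea_coords s = sea_coords t"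
    then have eq: "Poly_Mapping.lookup (sea_coords s) i = Poly_Mapping.lookup (sea_coords t) i" for i
      by simp
    show "s = t"
    proof (rule poly_mapping_eqI)
      fix k :: int
      show "Poly_Mapping.lookup s k = Poly_Mapping.lookup t k"
        using eq[of "nat k"] eq[of "nat (- 1 - k)"]
        by (cases "0 \<le> k") (simp_all add: sea_coords.rep_eq)
    qed
  qed
next
  show "surj sea_coords"
  proof (rule surjI)
    fix x :: "nat \<Rightarrow>\<^sub>0 bit \<times> bit"
    let ?x = "Poly_Mapping.lookup x"
    let ?s = "\<lambda>k::int. if 0 \<le> k then snd (?x (nat k)) else fst (?x (nat (- 1 - k)))"
    have "{k. ?s k \<noteq> 0} \<subseteq> int ` {i. ?x i \<noteq> 0} \<union> (\<lambda>i. - 1 - int i) ` {i. ?x i \<noteq> 0}"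
    proof
      fix k
      assume k: "k \<in> {k. ?s k \<noteq> 0}"
      show "k \<in> int ` {i. ?x i \<noteq> 0} \<union> (\<lambda>i. - 1 - int i) ` {i. ?x i \<noteq> 0}"
      proof (cases "0 \<le> k")
        case True
        then have "k \<in> int ` {i. ?x i \<noteq> 0}"
          using k by (intro image_eqI[where x = "nat k"]) auto
        then show ?thesis ..
      next
        case False
        then have "k \<in> (\<lambda>i. - 1 - int i) ` {i. ?x i \<noteq> 0}"
          using k by (intro image_eqI[where x = "nat (- 1 - k)"]) auto
        then show ?thesis ..
      qed
    qed
    then have fin: "finite {k. ?s k \<noteq> 0}"
      by (rule finite_subset) simp
    show "sea_coords (Abs_poly_mapping ?s) = x"
      by (rule poly_mapping_eqI) (simp only: sea_coords.rep_eq lookup_Abs_poly_mapping[OF fin], simp)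
  qed
qed

text \<open>Transport along the identification \<open>sea_coords\<close>.\<close>

definition is_substitutional_sea :: "'a set \<Rightarrow> (sea_level \<Rightarrow> 'a) set \<Rightarrow> bool" where
  "is_substitutional_sea A X \<longleftrightarrow>
     (\<exists>Z. is_substitutional A Z \<and> X = (\<lambda>z. z \<circ> sea_coords) ` Z)"

definition induced_shift :: "'a set \<Rightarrow> (sea_level \<Rightarrow> 'a) set \<Rightarrow> (lamplighter \<Rightarrow> 'a) set" where
  "induced_shift A X = {y \<in> UNIV \<rightarrow> A. \<forall>g. (\<lambda>h. y (sea_incl h + g)) \<in> X}"

end

theory Submission
  imports Defs "HOL-Library.Countable_Set"
begin

text \<open>
  By compactness, a point of a substitutional shift carries an infinite hierarchy of
  desubstitutions \<open>\<xi> 0, \<xi> 1, \<dots>\<close> together with offsets \<open>c 0, c 1, \<dots>\<close> that are constant over the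
  group. The fibres of \<open>\<L>\<close> over the different levels \<open>n\<close> are independent of each other, so a
  shift of finite type has to check one such hierarchy for every level. The value of
  \<open>\<xi> (k + 1)\<close> at level \<open>n\<close> does not depend on the lamps in \<open>[n - 1 - k, n + k]\<close>; it is written on
  those sites where these lamps spell \<open>0 1\<^sup>2\<^sup>k 0\<close>. Inside a run of ones the head moves freely with
  constant data, so both ends of the run can be reached, where the run is extended by local
  toggles to the left and then to the right: this compares \<open>\<xi> (k + 1)\<close> and \<open>\<xi> (k + 2)\<close> by local
  rules.

  It remains to force lamp labels and offsets to be independent of far away lamps. A datum at
  level \<open>n\<close> that is invariant under toggling the lamp just right of the head becomes invariant
  under all lamps to the right once it is transmitted upwards: a site receives the datum of the
  site below it if the lamp passed is \<open>0\<close>, and forwards what that site had received if it is \<open>1\<close>.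
  Thus every site transmits at most one message, and every datum is transmitted arbitrarily far.
  The mirror image gives invariance under the lamps to the left.
\<close>

subsection \<open>Compactness and desubstitution\<close>

lemma finite_keys_subset:
  assumes "finite I"
  shows "finite {t :: 'i \<Rightarrow>\<^sub>0 'f::{zero,finite}. Poly_Mapping.keys t \<subseteq> I}"
proof (rule inj_on_finite)
  show "inj_on Poly_Mapping.lookup {t :: 'i \<Rightarrow>\<^sub>0 'f. Poly_Mapping.keys t \<subseteq> I}"
    by (rule inj_onI) (simp add: poly_mapping_eqI)
  show "Poly_Mapping.lookup ` {t :: 'i \<Rightarrow>\<^sub>0 'f. Poly_Mapping.keys t \<subseteq> I}
      \<subseteq> {f. \<forall>i. (i \<in> I \<longrightarrow> f i \<in> UNIV) \<and> (i \<notin> I \<longrightarrow> f i = 0)}"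
    by (auto simp: in_keys_iff)
  show "finite {f :: 'i \<Rightarrow> 'f. \<forall>i. (i \<in> I \<longrightarrow> f i \<in> UNIV) \<and> (i \<notin> I \<longrightarrow> f i = 0)}"
    by (rule finite_set_of_finite_funs) (use assms in auto)
qed

lemma countable_UNIV_poly_mapping_nat:
  "countable (UNIV :: (nat \<Rightarrow>\<^sub>0 'f::{zero,finite}) set)"
proof -
  have "(UNIV :: (nat \<Rightarrow>\<^sub>0 'f) set) = (\<Union>n. {t. Poly_Mapping.keys t \<subseteq> {..<n}})"
    using finite_nat_bounded[OF finite_keys] by blast
  also have "countable \<dots>"
    by (rule countable_UN) (auto intro: countable_finite finite_keys_subset)
  finally show ?thesis .
qed

lemma finite_funcset_UNIV: "finite C \<Longrightarrow> finite (UNIV \<rightarrow> C :: ('a::finite \<Rightarrow> 'c) set)"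
  using finite_PiE[of "UNIV :: 'a set" "\<lambda>_. C"] by (simp add: PiE_UNIV_domain Pi_def)

text \<open>Nested infinite index sets \<open>F m\<close> fix one coordinate after the other; a
  finite set of coordinates is already constant on a single \<open>F M\<close>.\<close>

lemma finite_valued_limit:
  fixes g :: "nat \<Rightarrow> 'i \<Rightarrow> 'c"
  assumes C: "finite C" "\<And>n i. g n i \<in> C" and I: "countable (UNIV :: 'i set)"
  obtains h where "\<And>J. finite J \<Longrightarrow> infinite {n. \<forall>i\<in>J. g n i = h i}"
proof -
  define e :: "nat \<Rightarrow> 'i" where "e = from_nat_into UNIV"
  have surj: "\<exists>m. e m = i" for i
    unfolding e_def using from_nat_into_surj[OF I] by auto
  define good where "good m N \<longleftrightarrow> infinite N \<and> (\<forall>n\<in>N. \<forall>n'\<in>N. g n (e m) = g n' (e m))" for m N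
  have split: "\<exists>N'\<subseteq>N. good m N'" if "infinite N" for m N
  proof -
    have "finite ((\<lambda>n. g n (e m)) ` N)"
      using C by (meson finite_subset image_subsetI)
    from pigeonhole_infinite[OF that this] obtain n0 where "n0 \<in> N" "infinite {n \<in> N. g n (e m) = g n0 (e m)}"
      by blast
    then show ?thesis
      unfolding good_def by (intro exI[of _ "{n \<in> N. g n (e m) = g n0 (e m)}"]) auto
  qed
  have "\<exists>F. \<forall>m. good m (F m) \<and> F (Suc m) \<subseteq> F m"
  proof (rule dependent_nat_choice)
    show "\<exists>N. good 0 N"
      using split[of UNIV 0] by auto
    show "\<exists>N'. good (Suc m) N' \<and> N' \<subseteq> N" if "good m N" for m N
      using split[of N "Suc m"] that unfolding good_def by blast
  qed
  then obtain F where F: "\<And>m. good m (F m)" "\<And>m. F (Suc m) \<subseteq> F m"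
    by blast
  have anti: "F m' \<subseteq> F m" if "m \<le> m'" for m m'
    using lift_Suc_antimono_le[of F] F(2) that by blast
  have "\<exists>c. \<forall>n\<in>F m. g n (e m) = c" for m
    using F(1)[of m] unfolding good_def by (metis)
  then obtain c where c: "\<And>m n. n \<in> F m \<Longrightarrow> g n (e m) = c m"
    by metis
  obtain k where k: "\<And>i. e (k i) = i"
    using surj by (metis (full_types))
  show thesis
  proof (rule that[of "c \<circ> k"])
    fix J :: "'i set"
    assume "finite J"
    then obtain M where M: "\<And>i. i \<in> J \<Longrightarrow> k i \<le> M"
      by (meson finite_imageI finite_nat_set_iff_bounded_le imageI)
    have "F M \<subseteq> {n. \<forall>i\<in>J. g n i = (c \<circ> k) i}"
      using anti[OF M] c k by (auto, metis subsetD)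
    moreover have "infinite (F M)"
      using F(1) good_def by blast
    ultimately show "infinite {n. \<forall>i\<in>J. g n i = (c \<circ> k) i}"
      using finite_subset by blast
  qed
qed

section \<open>Desubstitution hierarchies\<close>

lemma lookup_fcons:
  "Poly_Mapping.lookup (fcons f k) i = (case i of 0 \<Rightarrow> f | Suc j \<Rightarrow> Poly_Mapping.lookup k j)"
  by transfer simp

lemma fcons_add_single:
  "fcons f k + Poly_Mapping.single 0 g = fcons (f + g) (k :: nat \<Rightarrow>\<^sub>0 'f::monoid_add)"
  by (rule poly_mapping_eqI) (simp add: lookup_add lookup_fcons lookup_single split: nat.split)

text \<open>
  \<open>\<pi> i k\<close> is the pattern that the substitution chooses at the letter \<open>\<xi> (Suc i) k\<close>. Only the levels
  \<open>i \<in> N\<close> are required to fit together.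
\<close>

definition hierarchy ::
  "'a set \<Rightarrow> ('a \<Rightarrow> ('f::{ab_group_add,finite} \<Rightarrow> 'a) set) \<Rightarrow> nat set \<Rightarrow>
    (nat \<Rightarrow> (nat \<Rightarrow>\<^sub>0 'f) \<Rightarrow> 'a) \<Rightarrow> (nat \<Rightarrow> (nat \<Rightarrow>\<^sub>0 'f) \<Rightarrow> 'f \<Rightarrow> 'a) \<Rightarrow> (nat \<Rightarrow> 'f) \<Rightarrow> bool" where
  "hierarchy A \<tau> N \<xi> \<pi> c \<longleftrightarrow> (\<forall>i k. \<xi> i k \<in> A) \<and> (\<forall>i k f. \<pi> i k f \<in> A) \<and>
     (\<forall>i\<in>N. \<forall>k. \<pi> i k \<in> \<tau> (\<xi> (Suc i) k) \<and> (\<forall>f. \<xi> i (fcons f k) = \<pi> i k (f + c i)))"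

text \<open>A shift by \<open>single 0 g\<close> moves coordinate \<open>0\<close> only, so it is
  absorbed into the argument \<open>f\<close>; the offsets \<open>c\<close> arise in this
  way.\<close>

lemma subst_step_iff:
  fixes \<tau> :: "'a \<Rightarrow> ('f::{ab_group_add,finite} \<Rightarrow> 'a) set"
  shows "x \<in> shift (Poly_Mapping.single 0 g) ` subst_map A \<tau> x' \<longleftrightarrow>
    (\<forall>h. x h \<in> A) \<and> (\<forall>k. (\<lambda>f. x (fcons (f - g) k)) \<in> \<tau> (x' k))"
    (is "?L \<longleftrightarrow> ?R")
proof
  assume ?L
  then obtain z where z: "z \<in> subst_map A \<tau> x'" "x = shift (Poly_Mapping.single 0 g) z"
    by blast
  then show ?R
    by (auto simp: subst_map_def shift_def fcons_add_single)
next
  assume R: ?R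
  define z where "z h = x (h - Poly_Mapping.single 0 g)" for h
  have "z (fcons f k) = x (fcons (f - g) k)" for f k
    using fcons_add_single[of f k "- g"] by (simp add: z_def single_uminus)
  then have "z \<in> subst_map A \<tau> x'"
    using R by (auto simp: subst_map_def z_def)
  moreover have "x = shift (Poly_Mapping.single 0 g) z"
    by (simp add: shift_def z_def fun_eq_iff)
  ultimately show ?L by blast
qed

lemma hierarchy_approx:
  assumes "x \<in> subst_approx A \<tau> n"
  shows "\<exists>\<xi> \<pi> c. hierarchy A \<tau> {..<n} \<xi> \<pi> c \<and> \<xi> 0 = x"
  using assms
proof (induction n arbitrary: x)
  case 0
  then show ?case
    by (intro exI[of _ "\<lambda>_. x"] exI[of _ "\<lambda>_ k _. x k"] exI[of _ "\<lambda>_. 0"]) (auto simp: hierarchy_def)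
next
  case (Suc n)
  then obtain g x' where x': "x' \<in> subst_approx A \<tau> n"
      and x: "x \<in> shift (Poly_Mapping.single 0 g) ` subst_map A \<tau> x'"
    by auto
  obtain \<xi> \<pi> c where h: "hierarchy A \<tau> {..<n} \<xi> \<pi> c" "\<xi> 0 = x'"
    using Suc.IH[OF x'] by blast
  have x: "\<forall>h. x h \<in> A" "\<forall>k. (\<lambda>f. x (fcons (f - g) k)) \<in> \<tau> (x' k)"
    using x subst_step_iff by blast+
  show ?case
  proof (intro exI conjI)
    \<comment> \<open>\<open>case_nat\<close> puts \<open>x\<close> below the hierarchy of
      \<open>x'\<close>, whose levels move up by one.\<close>
    show "hierarchy A \<tau> {..<Suc n} (case_nat x \<xi>) (case_nat (\<lambda>k f. x (fcons (f - g) k)) \<pi>) (case_nat g c)"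
      using h x by (auto simp: hierarchy_def split: nat.split)
  qed simp
qed

lemma hierarchy_imp_approx:
  assumes "hierarchy A \<tau> UNIV \<xi> \<pi> c"
  shows "\<xi> i \<in> subst_approx A \<tau> n"
proof (induction n arbitrary: i)
  case 0
  show ?case using assms by (auto simp: hierarchy_def)
next
  case (Suc n)
  have "(\<lambda>f. \<xi> i (fcons (f - c i) k)) = \<pi> i k" for k
    using assms by (auto simp: hierarchy_def)
  then have "\<xi> i \<in> shift (Poly_Mapping.single 0 (c i)) ` subst_map A \<tau> (\<xi> (Suc i))"
    unfolding subst_step_iff using assms by (auto simp: hierarchy_def)
  then show ?case using Suc.IH by auto
qed

lemma subst_shift_iff_hierarchy:
  fixes \<tau> :: "'a \<Rightarrow> ('f::{ab_group_add,finite} \<Rightarrow> 'a) set"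
  assumes "finite A"
  shows "x \<in> subst_shift A \<tau> \<longleftrightarrow> (\<exists>\<xi> \<pi> c. hierarchy A \<tau> UNIV \<xi> \<pi> c \<and> \<xi> 0 = x)"
proof
  assume x: "x \<in> subst_shift A \<tau>"
  have "\<exists>\<xi> \<pi> c. hierarchy A \<tau> {..<n} \<xi> \<pi> c \<and> \<xi> 0 = x" for n
    using hierarchy_approx[of x A \<tau> n] x by (simp add: subst_shift_def)
  then obtain \<xi> \<pi> c where h: "\<And>n. hierarchy A \<tau> {..<n} (\<xi> n) (\<pi> n) (c n)" "\<And>n. \<xi> n 0 = x"
    by metis
  \<comment> \<open>The offset is attached to every \<open>k\<close>, so that one limit serves all
    data; \<open>c'\<close> reads it at \<open>k = 0\<close>.\<close>
  define g where "g n = (\<lambda>(i, k). (\<xi> n i k, \<pi> n i k, c n i))" for n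
  have fin: "finite (A \<times> (UNIV \<rightarrow> A :: ('f \<Rightarrow> 'a) set) \<times> (UNIV :: 'f set))"
    using assms by (intro finite_cartesian_product finite_funcset_UNIV) auto
  have mem: "g n j \<in> A \<times> (UNIV \<rightarrow> A) \<times> UNIV" for n j
    using h(1)[of n] by (auto simp: g_def hierarchy_def split: prod.split)
  have cnt: "countable (UNIV :: (nat \<times> (nat \<Rightarrow>\<^sub>0 'f)) set)"
    unfolding UNIV_Times_UNIV[symmetric] by (intro countable_SIGMA countable_UNIV_poly_mapping_nat) simp
  obtain lim where lim: "\<And>J. finite J \<Longrightarrow> infinite {n. \<forall>j\<in>J. g n j = lim j}"
    using finite_valued_limit[where g = g, OF fin mem cnt] by blast
  have pick: "\<exists>n>m. \<forall>j\<in>J. g n j = lim j" if "finite J" for J m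
    using lim[OF that] unfolding infinite_nat_iff_unbounded by blast
  define \<xi>' where "\<xi>' i k = fst (lim (i, k))" for i k
  define \<pi>' where "\<pi>' i k = fst (snd (lim (i, k)))" for i k
  define c' where "c' i = snd (snd (lim (i, 0)))" for i
  have ext: "\<exists>n>m. \<forall>(i, k)\<in>J. \<xi>' i k = \<xi> n i k \<and> \<pi>' i k = \<pi> n i k \<and> (k = 0 \<longrightarrow> c' i = c n i)"
    if "finite J" for J m
  proof -
    from pick[OF that, of m] obtain n where "n > m" and n: "\<And>j. j \<in> J \<Longrightarrow> lim j = g n j"
      by metis
    have "\<xi>' i k = \<xi> n i k \<and> \<pi>' i k = \<pi> n i k \<and> (k = 0 \<longrightarrow> c' i = c n i)" if "(i, k) \<in> J" for i k
      using n[OF that] by (auto simp: \<xi>'_def \<pi>'_def c'_def g_def)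
    then show ?thesis using \<open>n > m\<close> by blast
  qed
  have "hierarchy A \<tau> UNIV \<xi>' \<pi>' c'"
    unfolding hierarchy_def
  proof (intro conjI allI ballI)
    fix i k f
    \<comment> \<open>These four sites carry everything that the constraint at \<open>i\<close>,
      \<open>k\<close>, \<open>f\<close> mentions; \<open>n > i\<close> puts level \<open>i\<close>
      among those that already fit together.\<close>
    obtain n where n: "n > i" and *: "\<forall>(i, k)\<in>{(i, 0), (i, k), (Suc i, k), (i, fcons f k)}.
        \<xi>' i k = \<xi> n i k \<and> \<pi>' i k = \<pi> n i k \<and> (k = 0 \<longrightarrow> c' i = c n i)"
      using ext[of "{(i, 0), (i, k), (Suc i, k), (i, fcons f k)}" i] by auto
    show "\<xi>' i k \<in> A" "\<pi>' i k f \<in> A" "\<pi>' i k \<in> \<tau> (\<xi>' (Suc i) k)" "\<xi>' i (fcons f k) = \<pi>' i k (f + c' i)"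
      using h(1)[of n] n * by (auto simp: hierarchy_def)
  qed
  moreover have "\<xi>' 0 = x"
  proof
    fix k
    show "\<xi>' 0 k = x k"
      using ext[of "{(0, k)}" 0] h(2) by auto
  qed
  ultimately show "\<exists>\<xi> \<pi> c. hierarchy A \<tau> UNIV \<xi> \<pi> c \<and> \<xi> 0 = x"
    by blast
qed (use hierarchy_imp_approx in \<open>auto simp: subst_shift_def\<close>)

subsection \<open>The local rules\<close>

text \<open>Forbidding every pattern on \<open>W\<close> that violates \<open>Q\<close> expresses
  the condition, and there are finitely many such patterns. \<open>enc\<close> supplies the alphabet
  inside \<open>nat\<close>.\<close>

lemma is_sofic_local_rule:
  fixes B :: "'c set" and W :: "'g::group_add set"
  assumes B: "finite B" and W: "finite W"
    and Q: "\<And>y y'. (\<And>h. h \<in> W \<Longrightarrow> y h = y' h) \<Longrightarrow> Q y = Q y'"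
    and \<phi>: "\<phi> \<in> B \<rightarrow> A"
  shows "is_sofic A ((\<lambda>y. \<phi> \<circ> y) ` {y \<in> UNIV \<rightarrow> B. \<forall>g. Q (shift g y)})"
proof -
  obtain enc :: "'c \<Rightarrow> nat" where enc: "inj_on enc B"
    using finite_imp_inj_to_nat_seg[OF B] by auto
  define dec where "dec = inv_into B enc"
  have dec: "dec (enc b) = b" if "b \<in> B" for b
    using that enc by (simp add: dec_def)
  have enc_dec: "enc (dec m) = m" "dec m \<in> B" if "m \<in> enc ` B" for m
    using that by (auto simp: dec_def f_inv_into_f inv_into_into)
  define P where "P = {p. dom p = W \<and> ran p \<subseteq> enc ` B \<and> \<not> Q (\<lambda>h. dec (the (p h)))}"
  have "finite P"
    by (rule finite_subset[OF _ finite_set_of_finite_maps[OF W finite_imageI[OF B, of enc]]]) (auto simp: P_def)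
  have occ: "(\<forall>p\<in>P. \<not> occurs_in p y) \<longleftrightarrow> (\<forall>g. Q (shift g (dec \<circ> y)))" if y: "y \<in> UNIV \<rightarrow> enc ` B" for y
  proof -
    have "(\<exists>p\<in>P. \<forall>h\<in>dom p. p h = Some (shift g y h)) \<longleftrightarrow> \<not> Q (shift g (dec \<circ> y))" for g
    proof
      assume "\<exists>p\<in>P. \<forall>h\<in>dom p. p h = Some (shift g y h)"
      then obtain p where p: "p \<in> P" "\<forall>h\<in>dom p. p h = Some (shift g y h)" by blast
      then have "Q (\<lambda>h. dec (the (p h))) = Q (shift g (dec \<circ> y))"
        by (intro Q) (auto simp: P_def shift_def)
      then show "\<not> Q (shift g (dec \<circ> y))"
        using p by (auto simp: P_def)
    next
      assume nQ: "\<not> Q (shift g (dec \<circ> y))"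
      define p where "p h = (if h \<in> W then Some (shift g y h) else None)" for h
      have "Q (\<lambda>h. dec (the (p h))) = Q (shift g (dec \<circ> y))"
        by (intro Q) (auto simp: p_def shift_def)
      then have "p \<in> P"
        using nQ y by (auto simp: P_def p_def dom_def ran_def shift_def split: if_splits)
      then show "\<exists>p\<in>P. \<forall>h\<in>dom p. p h = Some (shift g y h)"
        by (auto simp: p_def dom_def split: if_splits intro!: bexI[of _ p])
    qed
    then show ?thesis unfolding occurs_in_def by blast
  qed
  define Y where "Y = {y \<in> UNIV \<rightarrow> enc ` B. \<forall>p\<in>P. \<not> occurs_in p y}"
  have "is_sft (enc ` B) Y"
    unfolding is_sft_def Y_def using B \<open>finite P\<close> W
    by (intro conjI exI[of _ P]) (auto simp: pattern_over_def P_def)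
  moreover have "\<phi> \<circ> dec \<in> enc ` B \<rightarrow> A"
    using \<phi> enc_dec by auto
  moreover have "(\<lambda>y. \<phi> \<circ> y) ` {y \<in> UNIV \<rightarrow> B. \<forall>g. Q (shift g y)} = (\<lambda>y. (\<phi> \<circ> dec) \<circ> y) ` Y"
  proof (intro equalityI subsetI)
    fix z assume "z \<in> (\<lambda>y. \<phi> \<circ> y) ` {y \<in> UNIV \<rightarrow> B. \<forall>g. Q (shift g y)}"
    then obtain y where y: "y \<in> UNIV \<rightarrow> B" "\<forall>g. Q (shift g y)" "z = \<phi> \<circ> y" by blast
    have dy: "dec \<circ> (enc \<circ> y) = y"
      using y dec by (auto simp: fun_eq_iff)
    have "enc \<circ> y \<in> UNIV \<rightarrow> enc ` B"
      using y(1) by auto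
    then have "enc \<circ> y \<in> Y"
      using y(2) dy occ[of "enc \<circ> y"] by (simp add: Y_def)
    moreover have "z = (\<phi> \<circ> dec) \<circ> (enc \<circ> y)"
      using y(3) dy by (simp add: comp_assoc)
    ultimately show "z \<in> (\<lambda>y. (\<phi> \<circ> dec) \<circ> y) ` Y" by blast
  next
    fix z assume "z \<in> (\<lambda>y. (\<phi> \<circ> dec) \<circ> y) ` Y"
    then obtain y where y: "y \<in> Y" "z = (\<phi> \<circ> dec) \<circ> y" by blast
    then have "dec \<circ> y \<in> {y \<in> UNIV \<rightarrow> B. \<forall>g. Q (shift g y)}"
      using occ[of y] enc_dec(2) by (auto simp: Y_def Pi_iff)
    then show "z \<in> (\<lambda>y. \<phi> \<circ> y) ` {y \<in> UNIV \<rightarrow> B. \<forall>g. Q (shift g y)}"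
      using y(2) by (auto simp: comp_assoc)
  qed
  ultimately show ?thesis unfolding is_sofic_def by blast
qed

text \<open>
  The datum shared by all head positions in a run of ones. For a run of length \<open>2 k\<close>, \<open>sym\<close> is the
  letter of \<open>\<xi> (k + 1)\<close>, \<open>pat\<close> its pattern and \<open>off\<close> the offset \<open>c k\<close>. Extension of the run by one
  lamp to the left forgets the value of one lamp; \<open>half\<close> lists the letters of the shorter run for
  both values. Runs of odd length carry such data as well, so that no parity has to be checked.
\<close>

datatype 'a block =
  Block (sym: 'a) (pat: "bit \<times> bit \<Rightarrow> 'a") (half: "bit \<Rightarrow> 'a") (off: "bit \<times> bit")

text \<open>
  \<open>lam\<close> is the label of the lamp just right of the head, \<open>up\<close> and \<open>down\<close> are the messages received
  from below and from above.
\<close>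

datatype 'a cell =
  Cell (val: 'a) (lam: bit) (block: "'a block")
    (up: "bit \<times> bit \<times> bit") (down: "bit \<times> bit \<times> bit")

abbreviation toggle :: "int \<Rightarrow> bit \<Rightarrow> sea_level" where
  "toggle \<equiv> Poly_Mapping.single"

text \<open>
  The message that is to become independent of all lamps right of the head. The lamp at \<open>n\<close> is
  first set to \<open>0\<close>, so that the offset is that of a run ending at the head.
\<close>

definition left_msg :: "(sea_level \<Rightarrow> int \<Rightarrow> 'a cell) \<Rightarrow> sea_level \<Rightarrow> int \<Rightarrow> bit \<times> bit \<times> bit" where
  "left_msg Y s n = (lam (Y s (n - 1)), off (block (Y (s + toggle n (lam (Y s n))) n)))"

text \<open>The reflection of \<open>left_msg\<close>, to become independent of all lamps left of
  the head; the lamp at \<open>n - 1\<close> is the one set to \<open>0\<close>.\<close>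

definition right_msg :: "(sea_level \<Rightarrow> int \<Rightarrow> 'a cell) \<Rightarrow> sea_level \<Rightarrow> int \<Rightarrow> bit \<times> bit \<times> bit" where
  "right_msg Y s n =
    (lam (Y s n), off (block (Y (s + toggle (n - 1) (lam (Y s (n - 1)))) n)))"

text \<open>The last two clauses lengthen a run by one lamp, at its left end and at its right end;
  the second toggle gives the lamp beyond the new end the label \<open>0\<close>, so that the longer
  run stops there.\<close>

definition rule_at ::
  "('a \<Rightarrow> (bit \<times> bit \<Rightarrow> 'a) set) \<Rightarrow> (sea_level \<Rightarrow> int \<Rightarrow> 'a cell) \<Rightarrow> sea_level \<Rightarrow> int \<Rightarrow> bool" where
  "rule_at \<tau> Y s n \<longleftrightarrow>
    lam (Y (s + toggle n 1) n) \<noteq> lam (Y s n) \<and>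
    lam (Y (s + toggle (n - 1) 1) n) = lam (Y s n) \<and>
    lam (Y (s + toggle n 1) (n - 1)) = lam (Y s (n - 1)) \<and>
    up (Y (s + toggle n 1) n) = up (Y s n) \<and>
    up (Y s (n + 1)) = (if lam (Y s n) = 1 then up (Y s n) else left_msg Y s n) \<and>
    down (Y (s + toggle (n - 1) 1) n) = down (Y s n) \<and>
    down (Y s (n - 1)) = (if lam (Y s (n - 1)) = 1 then down (Y s n) else right_msg Y s n) \<and>
    pat (block (Y s n)) \<in> \<tau> (sym (block (Y s n))) \<and>
    (lam (Y s n) = 1 \<longrightarrow> block (Y s (n + 1)) = block (Y s n)) \<and>
    (lam (Y s (n - 1)) = 0 \<and> lam (Y s n) = 0 \<longrightarrow>
      (\<forall>f. val (Y (s + toggle (n - 1) (fst f) + toggle n (snd f)) n)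
          = pat (block (Y s n)) (f + off (block (Y s n))))) \<and>
    (lam (Y s (n - 1)) = 0 \<longrightarrow>
      half (block (Y (s + toggle (n - 1) 1 + toggle (n - 2) (lam (Y s (n - 2)))) n))
          (lam (Y s (n - 2))) = sym (block (Y s n))) \<and>
    (lam (Y s n) = 0 \<longrightarrow>
      (let B = block (Y (s + toggle n 1 + toggle (n + 1) (lam (Y s (n + 1)))) n)
       in \<forall>b. half (block (Y s n)) b = pat B ((b, lam (Y s (n + 1))) + off B)))"

definition cells :: "'a set \<Rightarrow> 'a cell set" where
  "cells A = {c. val c \<in> A \<and> sym (block c) \<in> A \<and> (\<forall>f. pat (block c) f \<in> A) \<and> (\<forall>b. half (block c) b \<in> A)}"

lemma finite_cells:
  assumes "finite A"
  shows "finite (cells A)"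
proof -
  let ?f = "\<lambda>(v, l, s, p, h, o', u, d). Cell v l (Block s p h o') u d"
  let ?D = "A \<times> UNIV \<times> A \<times> (UNIV \<rightarrow> A) \<times> (UNIV \<rightarrow> A) \<times> UNIV \<times> UNIV \<times> UNIV"
  have "cells A \<subseteq> ?f ` ?D"
  proof
    fix c assume "c \<in> cells A"
    then show "c \<in> ?f ` ?D"
      by (intro image_eqI[where x = "(val c, lam c, sym (block c), pat (block c), half (block c),
            off (block c), up c, down c)"]) (simp_all add: cells_def Pi_iff)
  qed
  moreover have "finite (?f ` ?D)"
    using assms by (intro finite_imageI finite_cartesian_product finite_funcset_UNIV) auto
  ultimately show ?thesis
    using finite_subset by blast
qed

section \<open>Toggles and the propagation of invariance\<close>

lemma bit_cases: "(b::bit) = 0 \<or> b = 1"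
  by (cases b) auto

lemma bit_add_self [simp]: "(b::bit) + b = 0"
  using bit_cases[of b] by auto

lemma bit_add_self_left [simp]: "(b::bit) + (b + c) = c"
  using bit_cases[of b] by auto

lemma toggle_toggle: "s + toggle n b + toggle n b = s"
  by (rule poly_mapping_eqI)
    (simp only: lookup_add lookup_single add.assoc bit_add_self add_0_right)

text \<open>
  Fix \<open>n\<close> and \<open>k > 0\<close>. Toggling \<open>n\<close> changes neither \<open>v n\<close> nor \<open>u n\<close>, so we may assume that the
  label at \<open>n\<close> is \<open>0\<close> (or \<open>1\<close>); then \<open>v n\<close> (or \<open>u n\<close>) is transmitted to \<open>u (n + 1)\<close>, which is closer
  to the toggle \<open>n + k\<close>.
\<close>

lemma transmitted_invariant:
  fixes T :: "int \<Rightarrow> 's \<Rightarrow> 's" and u v :: "int \<Rightarrow> 's \<Rightarrow> 'd" and l :: "int \<Rightarrow> 's \<Rightarrow> bit"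
  assumes comm: "\<And>i j s. T i (T j s) = T j (T i s)"
    and v: "\<And>n s. v n (T n s) = v n s"
    and u: "\<And>n s. u n (T n s) = u n s"
    and l: "\<And>n s. l n (T n s) \<noteq> l n s"
    and transmit: "\<And>n s. u (n + 1) s = (if l n s = 1 then u n s else v n s)"
    and label: "\<And>n s s'. v (n + 1) s = v (n + 1) s' \<Longrightarrow> l n s = l n s'"
  shows "v n (T (n + int k) s) = v n s \<and> u n (T (n + int k) s) = u n s"
proof (induction k arbitrary: n s)
  case 0
  then show ?case using u v by simp
next
  case (Suc k)
  let ?m = "n + int (Suc k)"
  have IH: "v (n + 1) (T ?m s) = v (n + 1) s" "u (n + 1) (T ?m s) = u (n + 1) s" for s
    using Suc.IH[of "n + 1" s] by (simp_all add: algebra_simps)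
  have lab: "l n (T ?m s) = l n s" for s
    using IH(1) label by blast
  have eq: "v n (T ?m s) = v n s" if "l n s = 0" for s
    using transmit[of n s] transmit[of n "T ?m s"] IH(2)[of s] lab[of s] that by simp
  have eq': "u n (T ?m s) = u n s" if "l n s = 1" for s
    using transmit[of n s] transmit[of n "T ?m s"] IH(2)[of s] lab[of s] that by simp
  have "v n (T ?m s) = v n s"
  proof (cases "l n s = 0")
    case False
    then have "l n (T n s) = 0"
      using l[of n s] bit_cases by metis
    then show ?thesis
      using eq[of "T n s"] v comm by metis
  qed (rule eq)
  moreover have "u n (T ?m s) = u n s"
  proof (cases "l n s = 1")
    case False
    then have "l n (T n s) = 1"
      using l[of n s] bit_cases by metis
    then show ?thesis
      using eq'[of "T n s"] u comm by metis
  qed (rule eq')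
  ultimately show ?case by simp
qed

text \<open>Two configurations differ at finitely many lamps, so single toggles lead from one to the
  other. \<open>P\<close> is a condition kept along the way.\<close>

lemma toggle_invariant_eq:
  fixes g :: "sea_level \<Rightarrow> 'd"
  assumes inv: "\<And>s i. P s \<Longrightarrow> i \<in> I \<Longrightarrow> P (s + toggle i 1) \<and> g (s + toggle i 1) = g s"
    and "P s" "\<And>i. i \<notin> I \<Longrightarrow> Poly_Mapping.lookup s i = Poly_Mapping.lookup s' i"
  shows "g s' = g s"
proof -
  have "finite J \<Longrightarrow> J \<subseteq> I \<Longrightarrow> {i. Poly_Mapping.lookup s i \<noteq> Poly_Mapping.lookup s' i} = J \<Longrightarrow> P s \<Longrightarrow> g s' = g s"
    for J s
  proof (induction J arbitrary: s rule: finite_induct)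
    case empty
    then have "s = s'" by (intro poly_mapping_eqI) auto
    then show ?case by simp
  next
    case (insert i J)
    have "{j. Poly_Mapping.lookup (s + toggle i 1) j \<noteq> Poly_Mapping.lookup s' j} = J"
    proof (rule set_eqI)
      fix j
      have "Poly_Mapping.lookup s j \<noteq> Poly_Mapping.lookup s' j \<longleftrightarrow> j \<in> insert i J"
        using insert.prems by blast
      then show "j \<in> {j. Poly_Mapping.lookup (s + toggle i 1) j \<noteq> Poly_Mapping.lookup s' j} \<longleftrightarrow> j \<in> J"
        using bit_cases[of "Poly_Mapping.lookup s j"] bit_cases[of "Poly_Mapping.lookup s' j"] insert.hyps(2)
        by (auto simp: lookup_add lookup_single when_def)
    qed
    then have "g s' = g (s + toggle i 1)"
      using insert inv[of s i] by auto
    then show ?case using insert.prems inv[of s i] by auto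
  qed
  moreover have "finite {i. Poly_Mapping.lookup s i \<noteq> Poly_Mapping.lookup s' i}"
    by (rule finite_subset[of _ "Poly_Mapping.keys s \<union> Poly_Mapping.keys s'"]) (auto simp: in_keys_iff)
  ultimately show ?thesis using assms(2,3) by blast
qed

lemma toggle_untoggle: "s + toggle n 1 + toggle n (b + 1) = s + toggle n b"
  using bit_cases[of b] by (auto simp: add.assoc simp flip: single_add)

subsection \<open>From tilings to hierarchies\<close>

locale tiling =
  fixes \<tau> :: "'a \<Rightarrow> (bit \<times> bit \<Rightarrow> 'a) set" and Y :: "sea_level \<Rightarrow> int \<Rightarrow> 'a cell"
  assumes rule: "\<And>s n. rule_at \<tau> Y s n"
begin

section \<open>Independence of labels and offsets from distant lamps\<close>

lemmas rule' = rule[unfolded rule_at_def]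

lemma lam_neq: "lam (Y (s + toggle n 1) n) \<noteq> lam (Y s n)"
  and lam_left: "lam (Y (s + toggle (n - 1) 1) n) = lam (Y s n)"
  and lam_right: "lam (Y (s + toggle n 1) (n - 1)) = lam (Y s (n - 1))"
  and up_toggle: "up (Y (s + toggle n 1) n) = up (Y s n)"
  and up_step: "up (Y s (n + 1)) = (if lam (Y s n) = 1 then up (Y s n) else left_msg Y s n)"
  and down_toggle: "down (Y (s + toggle (n - 1) 1) n) = down (Y s n)"
  and down_step: "down (Y s (n - 1)) = (if lam (Y s (n - 1)) = 1 then down (Y s n) else right_msg Y s n)"
  and pat_in: "pat (block (Y s n)) \<in> \<tau> (sym (block (Y s n)))"
  using rule'[of s n] by - (elim conjE, assumption)+

lemma block_step: "lam (Y s n) = 1 \<Longrightarrow> block (Y s (n + 1)) = block (Y s n)"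
  and val_pat: "lam (Y s (n - 1)) = 0 \<Longrightarrow> lam (Y s n) = 0 \<Longrightarrow>
      val (Y (s + toggle (n - 1) (fst f) + toggle n (snd f)) n)
          = pat (block (Y s n)) (f + off (block (Y s n)))"
  and half_sym: "lam (Y s (n - 1)) = 0 \<Longrightarrow>
      half (block (Y (s + toggle (n - 1) 1 + toggle (n - 2) (lam (Y s (n - 2)))) n))
          (lam (Y s (n - 2))) = sym (block (Y s n))"
  and half_pat: "lam (Y s n) = 0 \<Longrightarrow>
      B = block (Y (s + toggle n 1 + toggle (n + 1) (lam (Y s (n + 1)))) n) \<Longrightarrow>
      half (block (Y s n)) b = pat B ((b, lam (Y s (n + 1))) + off B)"
  using rule'[of s n] by (simp_all add: Let_def)

lemma toggle_lam: "lam (Y (s + toggle n 1) n) = lam (Y s n) + 1"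
  using lam_neq[of s n] bit_cases[of "lam (Y s n)"] bit_cases[of "lam (Y (s + toggle n 1) n)"]
  by auto

text \<open>The toggle flips the label at \<open>n\<close>, so the normalising toggle inside
  \<open>left_msg\<close> leads to the same configuration as before.\<close>

lemma left_msg_toggle: "left_msg Y (s + toggle n 1) n = left_msg Y s n"
  unfolding left_msg_def lam_right toggle_lam toggle_untoggle ..

lemma right_msg_toggle: "right_msg Y (s + toggle (n - 1) 1) n = right_msg Y s n"
  unfolding right_msg_def lam_left toggle_lam toggle_untoggle ..

lemma left_msg_invariant:
  assumes "i \<ge> n"
  shows "left_msg Y (s + toggle i 1) n = left_msg Y s n"
proof -
  have "left_msg Y (s + toggle (n + int (nat (i - n))) 1) n = left_msg Y s n \<and>
      up (Y (s + toggle (n + int (nat (i - n))) 1) n) = up (Y s n)"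
  proof (rule transmitted_invariant[where T = "\<lambda>i s. s + toggle i 1" and l = "\<lambda>n s. lam (Y s n)"
          and v = "\<lambda>n s. left_msg Y s n" and u = "\<lambda>n s. up (Y s n)"])
    show "s + toggle j 1 + toggle i 1 = s + toggle i 1 + toggle j 1" for s i j
      by (simp add: ac_simps)
    show "left_msg Y s (n + 1) = left_msg Y s' (n + 1) \<Longrightarrow> lam (Y s n) = lam (Y s' n)" for s s' n
      by (simp add: left_msg_def)
  qed (rule left_msg_toggle up_toggle lam_neq up_step)+
  then show ?thesis using assms by simp
qed

text \<open>Reflection sends head position \<open>n\<close> to \<open>- n\<close>, but lamp
  \<open>i\<close> to \<open>- 1 - i\<close>, since \<open>i\<close> encodes
  \<open>i + 1/2\<close>.\<close>

lemma right_msg_invariant: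
  assumes "i < n"
  shows "right_msg Y (s + toggle i 1) n = right_msg Y s n"
proof -
  have eq: "- (n + 1) = - n - 1" "- 1 - n = - n - 1" for n :: int
    by simp_all
  have "right_msg Y (s + toggle (- 1 - (- n + int (nat (n - 1 - i)))) 1) (- (- n)) = right_msg Y s (- (- n)) \<and>
      down (Y (s + toggle (- 1 - (- n + int (nat (n - 1 - i)))) 1) (- (- n))) = down (Y s (- (- n)))"
  proof (rule transmitted_invariant[where T = "\<lambda>i s. s + toggle (- 1 - i) 1"
          and l = "\<lambda>n s. lam (Y s (- 1 - n))"
          and v = "\<lambda>n s. right_msg Y s (- n)" and u = "\<lambda>n s. down (Y s (- n))"])
    show "s + toggle (- 1 - j) 1 + toggle (- 1 - i) 1 = s + toggle (- 1 - i) 1 + toggle (- 1 - j) 1" for s i j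
      by (simp add: ac_simps)
    show "right_msg Y s (- (n + 1)) = right_msg Y s' (- (n + 1)) \<Longrightarrow> lam (Y s (- 1 - n)) = lam (Y s' (- 1 - n))"
      for s s' n unfolding eq by (simp add: right_msg_def)
    show "right_msg Y (s + toggle (- 1 - n) 1) (- n) = right_msg Y s (- n)"
         "down (Y (s + toggle (- 1 - n) 1) (- n)) = down (Y s (- n))"
         "down (Y s (- (n + 1))) = (if lam (Y s (- 1 - n)) = 1 then down (Y s (- n)) else right_msg Y s (- n))"
      for s n
      using right_msg_toggle[of s "- n"] down_toggle[of s "- n"] down_step[of s "- n"]
      unfolding eq by simp_all
  qed (rule lam_neq)
  then show ?thesis using assms by simp
qed

text \<open>The label at \<open>n\<close> is part of \<open>left_msg\<close> at
  \<open>n + 1\<close>, which ignores lamps right of \<open>n\<close>, and of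
  \<open>right_msg\<close> at \<open>n\<close>, which ignores lamps left of
  \<open>n\<close>.\<close>

lemma lam_toggle_other:
  assumes "i \<noteq> n"
  shows "lam (Y (s + toggle i 1) n) = lam (Y s n)"
  using assms left_msg_invariant[of "n + 1" i s] right_msg_invariant[of i n s]
  by (cases "i < n") (auto simp: left_msg_def right_msg_def)

text \<open>Labels agree with lamps only up to this constant. It may have infinite support, so it
  cannot be absorbed by translating \<open>s\<close>.\<close>

definition lam0 :: "int \<Rightarrow> bit" where "lam0 n = lam (Y 0 n)"

lemma lam_eq: "lam (Y s n) = Poly_Mapping.lookup s n + lam0 n"
proof -
  have "lam (Y (toggle n (Poly_Mapping.lookup s n)) n) = lam (Y s n)"
    by (rule toggle_invariant_eq[where P = "\<lambda>_. True" and I = "- {n}" and g = "\<lambda>s. lam (Y s n)"])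
      (auto simp: lam_toggle_other lookup_single)
  moreover have "lam (Y (toggle n b) n) = b + lam0 n" for b
    using bit_cases[of b] toggle_lam[of 0 n] by (auto simp: lam0_def)
  ultimately show ?thesis by simp
qed

text \<open>With label \<open>0\<close> at \<open>n\<close> the normalising toggle is void, so the
  invariant message contains this very offset.\<close>

lemma off_right_toggle:
  assumes "lam (Y s n) = 0" "i > n"
  shows "off (block (Y (s + toggle i 1) n)) = off (block (Y s n))"
  using left_msg_invariant[of n i s] lam_toggle_other[of i n s] assms by (auto simp: left_msg_def)

lemma off_left_toggle:
  assumes "lam (Y s (n - 1)) = 0" "i < n - 1"
  shows "off (block (Y (s + toggle i 1) n)) = off (block (Y s n))"
  using right_msg_invariant[of i n s] lam_toggle_other[of i "n - 1" s] assms by (auto simp: right_msg_def)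

lemma block_run:
  assumes "m \<le> n" "\<And>i. m \<le> i \<Longrightarrow> i < n \<Longrightarrow> lam (Y s i) = 1"
  shows "block (Y s n) = block (Y s m)"
  using assms
proof (induction n rule: int_ge_induct)
  case (step n)
  then show ?case using block_step[of s n] by simp
qed simp

text \<open>The lamps labelled \<open>0 1\<^sup>2\<^sup>k 0\<close> around the head at level \<open>0\<close>, and \<open>\<kappa>\<close> outside.\<close>

definition frame :: "nat \<Rightarrow> (nat \<Rightarrow>\<^sub>0 bit \<times> bit) \<Rightarrow> sea_level" where
  "frame k \<kappa> = Abs_poly_mapping (\<lambda>i.
     if int k < i then snd (Poly_Mapping.lookup \<kappa> (nat (i - int k - 1)))
     else if i < - 1 - int k then fst (Poly_Mapping.lookup \<kappa> (nat (- 2 - int k - i)))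
     else lam0 i + (if - int k \<le> i \<and> i < int k then 1 else 0))"

lemma lookup_frame:
  "Poly_Mapping.lookup (frame k \<kappa>) i =
    (if int k < i then snd (Poly_Mapping.lookup \<kappa> (nat (i - int k - 1)))
     else if i < - 1 - int k then fst (Poly_Mapping.lookup \<kappa> (nat (- 2 - int k - i)))
     else lam0 i + (if - int k \<le> i \<and> i < int k then 1 else 0))"
  (is "_ = ?f i")
proof -
  have "{i. ?f i \<noteq> 0} \<subseteq> {- 1 - int k..int k} \<union> (\<lambda>j. int j + int k + 1) ` Poly_Mapping.keys \<kappa>
      \<union> (\<lambda>j. - 2 - int k - int j) ` Poly_Mapping.keys \<kappa>"
  proof
    fix i assume i: "i \<in> {i. ?f i \<noteq> 0}"
    consider "int k < i" | "i < - 1 - int k" | "i \<in> {- 1 - int k..int k}" by force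
    then show "i \<in> {- 1 - int k..int k} \<union> (\<lambda>j. int j + int k + 1) ` Poly_Mapping.keys \<kappa>
      \<union> (\<lambda>j. - 2 - int k - int j) ` Poly_Mapping.keys \<kappa>"
    proof cases
      case 1
      then have "i \<in> (\<lambda>j. int j + int k + 1) ` Poly_Mapping.keys \<kappa>"
        using i by (intro image_eqI[of _ _ "nat (i - int k - 1)"]) (auto simp: in_keys_iff)
      then show ?thesis by blast
    next
      case 2
      then have "i \<in> (\<lambda>j. - 2 - int k - int j) ` Poly_Mapping.keys \<kappa>"
        using i by (intro image_eqI[of _ _ "nat (- 2 - int k - i)"]) (auto simp: in_keys_iff)
      then show ?thesis by blast
    qed blast
  qed
  then have "finite {i. ?f i \<noteq> 0}"
    by (rule finite_subset) simp
  then show ?thesis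
    unfolding frame_def by simp
qed

lemma lam_frame:
  "- 1 - int k \<le> i \<Longrightarrow> i \<le> int k \<Longrightarrow>
    lam (Y (frame k \<kappa>) i) = (if - int k \<le> i \<and> i < int k then 1 else 0)"
  by (simp add: lam_eq lookup_frame)

text \<open>The coordinate \<open>f\<close> sits on the lamps next to the shorter frame. The toggles
  set the end lamps of that frame to label \<open>1\<close> and these next lamps to label
  \<open>0\<close>, as the two extension rules do.\<close>

lemma frame_Suc:
  "frame (Suc k) \<kappa> = frame k (fcons f \<kappa>) + toggle (- int k - 1) 1 + toggle (- int k - 2) (fst f + lam0 (- int k - 2))
     + toggle (int k) 1 + toggle (int k + 1) (snd f + lam0 (int k + 1))"
proof (rule poly_mapping_eqI)
  fix i
  consider "i = - int k - 2" | "i = - int k - 1" | "i = int k" | "i = int k + 1" | "- int k \<le> i" "i < int k"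
    | "i > int k + 1" | "i < - int k - 2" by force
  then show "Poly_Mapping.lookup (frame (Suc k) \<kappa>) i = Poly_Mapping.lookup (frame k (fcons f \<kappa>) + toggle (- int k - 1) 1
      + toggle (- int k - 2) (fst f + lam0 (- int k - 2)) + toggle (int k) 1 + toggle (int k + 1) (snd f + lam0 (int k + 1))) i"
  proof cases
    case 6
    then have "nat (i - int k - 1) = Suc (nat (i - int k - 2))" by simp
    then show ?thesis
      using 6 by (simp add: lookup_frame lookup_add lookup_single when_def lookup_fcons algebra_simps)
  next
    case 7
    define m where "m = nat (- 3 - int k - i)"
    have "i = - 3 - int k - int m" using 7 by (simp add: m_def)
    moreover have "nat (1 + int m) = Suc m" by simp
    ultimately show ?thesis
      by (simp add: lookup_frame lookup_add lookup_single when_def lookup_fcons)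
  qed (auto simp: lookup_frame lookup_add lookup_single when_def lookup_fcons add.commute)
qed

lemma sea_coords_frame_0:
  "sea_coords (frame 0 \<kappa> + toggle (- 1) (fst f + lam0 (- 1)) + toggle 0 (snd f + lam0 0)) = fcons f \<kappa>"
proof (rule poly_mapping_eqI)
  fix i
  show "Poly_Mapping.lookup (sea_coords (frame 0 \<kappa> + toggle (- 1) (fst f + lam0 (- 1)) + toggle 0 (snd f + lam0 0))) i
      = Poly_Mapping.lookup (fcons f \<kappa>) i"
  proof (cases i)
    case 0
    then show ?thesis
      using bit_cases[of "lam0 (- 1)"] bit_cases[of "lam0 0"]
      by (auto simp: sea_coords.rep_eq lookup_frame lookup_add lookup_single when_def lookup_fcons prod_eq_iff)
  next
    case (Suc j)
    have "nat (int (Suc j) - 1) = j" "nat (int (Suc j) - int 0 - 1) = j" by simp_all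
    with Suc show ?thesis
      by (simp add: sea_coords.rep_eq lookup_frame lookup_add lookup_single when_def lookup_fcons prod_eq_iff)
  qed
qed

lemma block_centre:
  assumes "\<And>i. - int k \<le> i \<Longrightarrow> i < int k \<Longrightarrow> lam (Y s i) = 1" "- int k \<le> n" "n \<le> int k"
  shows "block (Y s n) = block (Y s 0)"
proof (cases "n \<le> 0")
  case True
  then show ?thesis
    using block_run[of n 0 s] assms by simp
next
  case False
  then show ?thesis
    using block_run[of 0 n s] assms by simp
qed

text \<open>Seen from the right end of the run the offset ignores all lamps further right, from the
  left end all those further left, and the block is the same at both ends. Hence \<open>c\<close>
  can be constant over the group.\<close>

lemma off_frame: "off (block (Y (frame k \<kappa>) 0)) = off (block (Y (frame k 0) 0))"
proof (rule toggle_invariant_eq[where g = "\<lambda>s. off (block (Y s 0))" and I = "{i. i > int k \<or> i < - 1 - int k}"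
      and P = "\<lambda>s. \<forall>i. - 1 - int k \<le> i \<and> i \<le> int k \<longrightarrow> lam (Y s i) = (if - int k \<le> i \<and> i < int k then 1 else 0)"])
  fix s i
  assume P: "\<forall>i. - 1 - int k \<le> i \<and> i \<le> int k \<longrightarrow> lam (Y s i) = (if - int k \<le> i \<and> i < int k then 1 else 0)"
    and i: "i \<in> {i. i > int k \<or> i < - 1 - int k}"
  let ?s = "s + toggle i 1"
  have P': "\<forall>i. - 1 - int k \<le> i \<and> i \<le> int k \<longrightarrow> lam (Y ?s i) = (if - int k \<le> i \<and> i < int k then 1 else 0)"
    using P i by (auto simp: lam_toggle_other)
  have c: "block (Y s n) = block (Y s 0)" "block (Y ?s n) = block (Y ?s 0)" if "n = int k \<or> n = - int k" for n
    using block_centre[of k s n] block_centre[of k ?s n] P P' that by auto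
  have "off (block (Y ?s 0)) = off (block (Y s 0))"
  proof (cases "i > int k")
    case True
    then show ?thesis using off_right_toggle[of s "int k" i] c[of "int k"] P by simp
  next
    case False
    then show ?thesis using off_left_toggle[of s "- int k" i] c[of "- int k"] P i by simp
  qed
  then show "(\<forall>i. - 1 - int k \<le> i \<and> i \<le> int k \<longrightarrow> lam (Y ?s i) = (if - int k \<le> i \<and> i < int k then 1 else 0))
      \<and> off (block (Y ?s 0)) = off (block (Y s 0))"
    using P' by blast
qed (auto simp: lam_frame lookup_frame)

lemma hierarchy_of_tiling:
  assumes cells: "\<And>s n. Y s n \<in> cells A"
  shows "\<exists>\<xi> \<pi> c. hierarchy A \<tau> UNIV \<xi> \<pi> c \<and> (\<forall>s. \<xi> 0 (sea_coords s) = val (Y s 0))"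
proof -
  define \<xi> where "\<xi> i \<kappa> = (case i of 0 \<Rightarrow> val (Y (inv sea_coords \<kappa>) 0)
    | Suc k \<Rightarrow> sym (block (Y (frame k \<kappa>) 0)))" for i \<kappa>
  define \<pi> where "\<pi> k \<kappa> = pat (block (Y (frame k \<kappa>) 0))" for k \<kappa>
  \<comment> \<open>The rules compare labels; \<open>lam0\<close> at the two lamps of coordinate
    \<open>k\<close> converts lamp values into labels.\<close>
  define c where "c k = (lam0 (- int k - 1), lam0 (int k)) + off (block (Y (frame k 0) 0))" for k
  have \<xi>0: "\<xi> 0 (sea_coords s) = val (Y s 0)" for s
    by (simp add: \<xi>_def inv_f_f[OF bij_is_inj[OF bij_sea_coords]])
  have "\<xi> k (fcons f \<kappa>) = \<pi> k \<kappa> (f + c k)" for k f \<kappa>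
  proof (cases k)
    case 0
    have "\<xi> 0 (fcons f \<kappa>) = val (Y (frame 0 \<kappa> + toggle (- 1) (fst f + lam0 (- 1)) + toggle 0 (snd f + lam0 0)) 0)"
      using \<xi>0 sea_coords_frame_0 by metis
    also have "\<dots> = pat (block (Y (frame 0 \<kappa>) 0)) (f + (lam0 (- 1), lam0 0) + off (block (Y (frame 0 \<kappa>) 0)))"
      using val_pat[of "frame 0 \<kappa>" 0 "f + (lam0 (- 1), lam0 0)"] lam_frame[of 0 _ \<kappa>] by simp
    finally show ?thesis
      using 0 off_frame[of 0 \<kappa>] by (simp add: \<pi>_def c_def add.assoc)
  next
    case (Suc j)
    let ?k = "int j"
    \<comment> \<open>From \<open>s\<close> to \<open>s1\<close> the run grows to the left, from
      \<open>s1\<close> to \<open>s2\<close> to the right; in between the head crosses from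
      \<open>- ?k\<close> to \<open>?k\<close> inside the run.\<close>
    define s where "s = frame j (fcons f \<kappa>)"
    define s1 where "s1 = s + toggle (- ?k - 1) 1 + toggle (- ?k - 2) (fst f + lam0 (- ?k - 2))"
    define s2 where "s2 = s1 + toggle ?k 1 + toggle (?k + 1) (snd f + lam0 (?k + 1))"
    have s2: "s2 = frame k \<kappa>"
      unfolding s2_def s1_def s_def Suc frame_Suc[of j \<kappa> f] ..
    have lam_s: "lam (Y s (- ?k - 2)) = fst f + lam0 (- ?k - 2)" "lam (Y s (- ?k - 1)) = 0"
      using lam_frame[of j "- ?k - 1" "fcons f \<kappa>"]
      by (simp_all add: s_def lam_eq lookup_frame lookup_fcons)
    have lam_s1: "lam (Y s1 i) = (if - ?k - 1 \<le> i \<and> i < ?k then 1 else 0)" if "- ?k - 1 \<le> i" "i \<le> ?k" for i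
      using lam_frame[of j i "fcons f \<kappa>"] that
      by (auto simp: s_def s1_def lam_eq lookup_add lookup_single when_def lookup_frame)
    have lam_s1': "lam (Y s1 (?k + 1)) = snd f + lam0 (?k + 1)"
      by (simp add: s_def s1_def lam_eq lookup_add lookup_single when_def lookup_frame lookup_fcons)
    have "\<xi> k (fcons f \<kappa>) = sym (block (Y s (- ?k)))"
      using block_centre[of j s "- ?k"] lam_frame[of j _ "fcons f \<kappa>"] by (simp add: \<xi>_def Suc s_def)
    also have "\<dots> = half (block (Y s1 (- ?k))) (fst f + lam0 (- ?k - 2))"
      using half_sym[of s "- ?k"] lam_s by (simp add: s1_def)
    also have "block (Y s1 (- ?k)) = block (Y s1 ?k)"
      using block_centre[of j s1 "- ?k"] block_centre[of j s1 ?k] lam_s1 by simp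
    also have "half (block (Y s1 ?k)) (fst f + lam0 (- ?k - 2))
        = pat (block (Y s2 ?k)) ((fst f + lam0 (- ?k - 2), snd f + lam0 (?k + 1)) + off (block (Y s2 ?k)))"
      using half_pat[of s1 ?k "block (Y s2 ?k)"] lam_s1[of ?k] lam_s1' by (simp add: s2_def)
    also have "block (Y s2 ?k) = block (Y (frame k \<kappa>) 0)"
      unfolding s2 by (rule block_centre[of k]) (auto simp: lam_frame Suc)
    also have "(fst f + lam0 (- ?k - 2), snd f + lam0 (?k + 1)) = f + (lam0 (- int k - 1), lam0 (int k))"
      by (cases f) (simp add: Suc algebra_simps)
    finally show ?thesis
      using off_frame[of k \<kappa>] by (simp add: \<pi>_def c_def add.assoc)
  qed
  moreover have "\<pi> i k \<in> \<tau> (\<xi> (Suc i) k)" for i k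
    by (simp add: \<pi>_def \<xi>_def pat_in)
  ultimately have "hierarchy A \<tau> UNIV \<xi> \<pi> c"
    using cells unfolding hierarchy_def by (auto simp: \<xi>_def \<pi>_def cells_def split: nat.split)
  with \<xi>0 show ?thesis by blast
qed

end

subsection \<open>From hierarchies to tilings\<close>

definition run_end :: "sea_level \<Rightarrow> int \<Rightarrow> int" where
  "run_end s n = n + int (LEAST j. Poly_Mapping.lookup s (n + int j) = 0)"

text \<open>The run touching head position \<open>n\<close> is
  \<open>[run_start s n, run_end s n)\<close>, empty if both adjacent lamps are off.\<close>

definition run_start :: "sea_level \<Rightarrow> int \<Rightarrow> int" where
  "run_start s n = n - int (LEAST j. Poly_Mapping.lookup s (n - 1 - int j) = 0)"

lemma eventually_unlit:
  fixes s :: sea_level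
  assumes "inj h"
  shows "\<exists>j::nat. Poly_Mapping.lookup s (h j) = 0"
proof (rule ccontr)
  assume "\<not> ?thesis"
  then have "range h \<subseteq> Poly_Mapping.keys s"
    by (auto simp: in_keys_iff)
  then have "finite (range h)"
    by (rule finite_subset) simp
  then show False
    using range_inj_infinite[OF assms] by simp
qed

lemma run_end:
  "n \<le> run_end s n" "Poly_Mapping.lookup s (run_end s n) = 0"
  "n \<le> i \<Longrightarrow> i < run_end s n \<Longrightarrow> Poly_Mapping.lookup s i = 1"
proof -
  have "\<exists>j. Poly_Mapping.lookup s (n + int j) = 0"
    by (rule eventually_unlit[of "\<lambda>j. n + int j"]) (simp add: inj_def)
  then show "Poly_Mapping.lookup s (run_end s n) = 0"
    unfolding run_end_def by (rule LeastI_ex)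
  show "n \<le> run_end s n" by (simp add: run_end_def)
  show "Poly_Mapping.lookup s i = 1" if "n \<le> i" "i < run_end s n"
    using that not_less_Least[of "nat (i - n)" "\<lambda>j. Poly_Mapping.lookup s (n + int j) = 0"]
    by (auto simp: run_end_def)
qed

lemma run_start:
  "run_start s n \<le> n" "Poly_Mapping.lookup s (run_start s n - 1) = 0"
  "run_start s n \<le> i \<Longrightarrow> i < n \<Longrightarrow> Poly_Mapping.lookup s i = 1"
proof -
  have "\<exists>j. Poly_Mapping.lookup s (n - 1 - int j) = 0"
    by (rule eventually_unlit[of "\<lambda>j. n - 1 - int j"]) (simp add: inj_def)
  from LeastI_ex[OF this] show "Poly_Mapping.lookup s (run_start s n - 1) = 0"
    unfolding run_start_def diff_right_commute[of n _ 1] .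
  show "run_start s n \<le> n" by (simp add: run_start_def)
  show "Poly_Mapping.lookup s i = 1" if "run_start s n \<le> i" "i < n"
    using that not_less_Least[of "nat (n - 1 - i)" "\<lambda>j. Poly_Mapping.lookup s (n - 1 - int j) = 0"]
    by (auto simp: run_start_def)
qed

lemma run_end_eqI:
  assumes "n \<le> p" "Poly_Mapping.lookup s p = 0"
    "\<And>i. n \<le> i \<Longrightarrow> i < p \<Longrightarrow> Poly_Mapping.lookup s i = 1"
  shows "run_end s n = p"
  using assms run_end[where n = n and s = s] by (metis linorder_less_linear zero_neq_one)

lemma run_start_eqI:
  assumes "q \<le> n" "Poly_Mapping.lookup s (q - 1) = 0"
    "\<And>i. q \<le> i \<Longrightarrow> i < n \<Longrightarrow> Poly_Mapping.lookup s i = 1"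
  shows "run_start s n = q"
proof (rule linorder_cases[of "run_start s n" q])
  assume "run_start s n < q"
  then show ?thesis using run_start(3)[of s n "q - 1"] assms by simp
next
  assume "q < run_start s n"
  then show ?thesis using run_start(1,2)[of s n] assms(3)[of "run_start s n - 1"] by simp
qed

lemma run_end_cong:
  assumes "\<And>i. n \<le> i \<Longrightarrow> Poly_Mapping.lookup s i = Poly_Mapping.lookup s' i"
  shows "run_end s n = run_end s' n"
  using run_end[where n = n and s = s'] assms by (intro run_end_eqI) auto

lemma run_start_cong:
  assumes "\<And>i. i < n \<Longrightarrow> Poly_Mapping.lookup s i = Poly_Mapping.lookup s' i"
  shows "run_start s n = run_start s' n"
  using run_start[of s' n] assms by (intro run_start_eqI) auto

lemma run_end_self: "Poly_Mapping.lookup s n = 0 \<Longrightarrow> run_end s n = n"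
  by (rule run_end_eqI) auto

lemma run_start_self: "Poly_Mapping.lookup s (n - 1) = 0 \<Longrightarrow> run_start s n = n"
  by (rule run_start_eqI) auto

lemma run_end_step:
  assumes "Poly_Mapping.lookup s n = 1"
  shows "run_end s n = run_end s (n + 1)"
proof (rule run_end_eqI)
  show "Poly_Mapping.lookup s i = 1" if "n \<le> i" "i < run_end s (n + 1)" for i
    using that assms run_end(3)[of "n + 1" i s] by (cases "i = n") auto
qed (use run_end(1,2)[where n = "n + 1" and s = s] in auto)

lemma run_start_step:
  assumes "Poly_Mapping.lookup s n = 1"
  shows "run_start s (n + 1) = run_start s n"
proof (rule run_start_eqI)
  show "Poly_Mapping.lookup s i = 1" if "run_start s n \<le> i" "i < n + 1" for i
    using that assms run_start(3)[of s n i] by (cases "i = n") auto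
qed (use run_start(1,2)[of s n] in auto)

text \<open>For \<open>q = - int k\<close> and \<open>p = int k\<close> this recovers
  \<open>\<kappa>\<close> from \<open>frame k \<kappa>\<close>. For \<open>q = n + 1\<close> and
  \<open>p = n - 1\<close> no lamp is skipped: it is the whole configuration seen from head position
  \<open>n\<close>.\<close>

definition outside :: "int \<Rightarrow> int \<Rightarrow> sea_level \<Rightarrow> (nat \<Rightarrow>\<^sub>0 bit \<times> bit)" where
  "outside q p s = Abs_poly_mapping (\<lambda>i. (Poly_Mapping.lookup s (q - 2 - int i), Poly_Mapping.lookup s (p + 1 + int i)))"

lemma lookup_outside:
  "Poly_Mapping.lookup (outside q p s) i = (Poly_Mapping.lookup s (q - 2 - int i), Poly_Mapping.lookup s (p + 1 + int i))"
proof -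
  have "finite ((\<lambda>i. q - 2 - int i) -` Poly_Mapping.keys s \<union> (\<lambda>i. p + 1 + int i) -` Poly_Mapping.keys s)"
    by (intro finite_UnI finite_vimageI finite_keys) (auto simp: inj_def)
  then have "finite {i. (Poly_Mapping.lookup s (q - 2 - int i), Poly_Mapping.lookup s (p + 1 + int i)) \<noteq> 0}"
    by (rule finite_subset[rotated]) (auto simp: zero_prod_def in_keys_iff)
  then show ?thesis unfolding outside_def by simp
qed

lemma outside_cong:
  assumes "\<And>i. i < q - 1 \<or> p < i \<Longrightarrow> Poly_Mapping.lookup s i = Poly_Mapping.lookup s' i"
  shows "outside q p s = outside q p s'"
  using assms by (intro poly_mapping_eqI) (simp add: lookup_outside)

lemma outside_fcons:
  "outside (q + 1) (p - 1) s = fcons (Poly_Mapping.lookup s (q - 1), Poly_Mapping.lookup s p) (outside q p s)"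
  by (rule poly_mapping_eqI) (simp add: lookup_outside lookup_fcons algebra_simps split: nat.split)

section \<open>Cells computed from one hierarchy per level\<close>

locale level_hierarchies =
  fixes A :: "'a set" and \<tau> :: "'a \<Rightarrow> (bit \<times> bit \<Rightarrow> 'a) set"
    and \<xi> :: "int \<Rightarrow> nat \<Rightarrow> (nat \<Rightarrow>\<^sub>0 bit \<times> bit) \<Rightarrow> 'a"
    and \<pi> :: "int \<Rightarrow> nat \<Rightarrow> (nat \<Rightarrow>\<^sub>0 bit \<times> bit) \<Rightarrow> bit \<times> bit \<Rightarrow> 'a"
    and c :: "int \<Rightarrow> nat \<Rightarrow> bit \<times> bit"
  assumes hierarchy: "\<And>n. hierarchy A \<tau> UNIV (\<xi> n) (\<pi> n) (c n)"
begin

lemma \<xi>_fcons: "\<xi> n i (fcons f \<kappa>) = \<pi> n i \<kappa> (f + c n i)"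
  and \<pi>_in: "\<pi> n i \<kappa> \<in> \<tau> (\<xi> n (Suc i) \<kappa>)"
  and \<xi>_range: "\<xi> n i \<kappa> \<in> A"
  and \<pi>_range: "\<pi> n i \<kappa> f \<in> A"
  using hierarchy[of n] unfolding hierarchy_def by blast+

text \<open>
  A run \<open>[q, p)\<close> is centred at level \<open>(q + p) div 2\<close>. In \<open>run_sym\<close>, lengths \<open>p - q = - 2\<close> and
  \<open>p - q = - 1\<close> also occur, and there the index is \<open>0\<close>, i.e. the original configuration.
\<close>

definition offset :: "int \<Rightarrow> int \<Rightarrow> bit \<times> bit" where
  "offset q p = c ((q + p) div 2) (nat ((p - q) div 2))"

definition run_sym :: "int \<Rightarrow> int \<Rightarrow> sea_level \<Rightarrow> 'a" where
  "run_sym q p s = \<xi> ((q + p) div 2) (nat ((p - q) div 2 + 1)) (outside q p s)"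

definition run_pat :: "int \<Rightarrow> int \<Rightarrow> sea_level \<Rightarrow> bit \<times> bit \<Rightarrow> 'a" where
  "run_pat q p s = \<pi> ((q + p) div 2) (nat ((p - q) div 2)) (outside q p s)"

text \<open>Removing both end lamps keeps the centre and lowers the index by one, so this is the
  hierarchy equation with \<open>f\<close> the lamps at \<open>q - 1\<close> and
  \<open>p\<close>.\<close>

lemma run_sym_inner:
  assumes "q \<le> p"
  shows "run_sym (q + 1) (p - 1) s
    = run_pat q p s ((Poly_Mapping.lookup s (q - 1), Poly_Mapping.lookup s p) + offset q p)"
proof -
  have "(p - 1 - (q + 1)) div 2 + 1 = (p - q) div 2" by simp
  then show ?thesis
    unfolding run_sym_def run_pat_def offset_def outside_fcons by (simp add: \<xi>_fcons)
qed

text \<open>Received messages are constant along a run: \<open>up\<close> was sent from level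
  \<open>q - 1\<close>, \<open>down\<close> from level \<open>p + 1\<close>.\<close>

definition cell_at :: "sea_level \<Rightarrow> int \<Rightarrow> 'a cell" where
  "cell_at s n = (let q = run_start s n; p = run_end s n in
    Cell (run_sym (n + 1) (n - 1) s) (Poly_Mapping.lookup s n)
      (Block (run_sym q p s) (run_pat q p s)
        (\<lambda>b. run_sym (q + 1) p (s + toggle (q - 1) b)) (offset q p))
      (Poly_Mapping.lookup s (q - 2), offset (run_start s (q - 1)) (q - 1))
      (Poly_Mapping.lookup s (p + 1), offset (p + 1) (run_end s (p + 1))))"

lemma cell_at_in_cells: "cell_at s n \<in> cells A"
  by (simp add: cell_at_def Let_def cells_def run_sym_def run_pat_def \<xi>_range \<pi>_range)

lemma rule_at_cell_at: "rule_at \<tau> cell_at s n"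
  unfolding rule_at_def
proof (intro conjI impI)
  let ?l = "Poly_Mapping.lookup"
  note upd = lookup_add lookup_single when_def
  note lam = cell_at_def Let_def
  show "lam (cell_at (s + toggle n 1) n) \<noteq> lam (cell_at s n)"
    "lam (cell_at (s + toggle (n - 1) 1) n) = lam (cell_at s n)"
    "lam (cell_at (s + toggle n 1) (n - 1)) = lam (cell_at s (n - 1))"
    by (simp_all add: lam upd)
  have start_cong: "run_start s' m = run_start s m" if "\<And>i. i < m \<Longrightarrow> ?l s' i = ?l s i" for s' m
    using that by (rule run_start_cong)
  have end_cong: "run_end s' m = run_end s m" if "\<And>i. i \<ge> m \<Longrightarrow> ?l s' i = ?l s i" for s' m
    using that by (rule run_end_cong)
  note start_le = run_start(1)[of s n] and end_ge = run_end(1)[of n s]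
  have "run_start (s + toggle n 1) n = run_start s n"
    "run_start (s + toggle n 1) (run_start s n - 1) = run_start s (run_start s n - 1)"
    using start_le by (auto intro!: start_cong simp: upd)
  then show "up (cell_at (s + toggle n 1) n) = up (cell_at s n)"
    using start_le by (simp add: lam upd)
  have "run_end (s + toggle (n - 1) 1) n = run_end s n"
    "run_end (s + toggle (n - 1) 1) (run_end s n + 1) = run_end s (run_end s n + 1)"
    using end_ge by (auto intro!: end_cong simp: upd)
  then show "down (cell_at (s + toggle (n - 1) 1) n) = down (cell_at s n)"
    using end_ge by (simp add: lam upd)
  show "up (cell_at s (n + 1)) = (if lam (cell_at s n) = 1 then up (cell_at s n) else left_msg cell_at s n)"
    using run_start_step[of s n] run_start_self[of s "n + 1"] run_end_self[of s n] bit_cases[of "?l s n"]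
    by (auto simp: lam left_msg_def)
  show "down (cell_at s (n - 1)) = (if lam (cell_at s (n - 1)) = 1 then down (cell_at s n) else right_msg cell_at s n)"
    using run_end_step[of s "n - 1"] run_end_self[of s "n - 1"] run_start_self[of s n] bit_cases[of "?l s (n - 1)"]
    by (auto simp: lam right_msg_def)
  have "nat ((run_end s n - run_start s n) div 2 + 1) = Suc (nat ((run_end s n - run_start s n) div 2))"
    using start_le end_ge by (simp add: nat_add_distrib)
  then show "pat (block (cell_at s n)) \<in> \<tau> (sym (block (cell_at s n)))"
    using \<pi>_in by (simp add: lam run_pat_def run_sym_def)
  show "block (cell_at s (n + 1)) = block (cell_at s n)" if "lam (cell_at s n) = 1"
    using that run_start_step[of s n] run_end_step[of s n] by (simp add: lam)
  show "\<forall>f. val (cell_at (s + toggle (n - 1) (fst f) + toggle n (snd f)) n)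
      = pat (block (cell_at s n)) (f + off (block (cell_at s n)))"
    if "lam (cell_at s (n - 1)) = 0 \<and> lam (cell_at s n) = 0"
  proof
    fix f
    let ?s = "s + toggle (n - 1) (fst f) + toggle n (snd f)"
    have z: "?l s (n - 1) = 0" "?l s n = 0" using that by (simp_all add: lam)
    then have "run_start s n = n" "run_end s n = n"
      by (simp_all add: run_start_self run_end_self)
    moreover have "(?l ?s (n - 1), ?l ?s n) = f"
      using z by (cases f) (auto simp: upd)
    moreover have "outside n n ?s = outside n n s"
      by (rule outside_cong) (auto simp: upd)
    ultimately show "val (cell_at ?s n) = pat (block (cell_at s n)) (f + off (block (cell_at s n)))"
      using run_sym_inner[of n n ?s] by (simp add: lam run_pat_def)
  qed
  show "half (block (cell_at (s + toggle (n - 1) 1 + toggle (n - 2) (lam (cell_at s (n - 2)))) n))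
      (lam (cell_at s (n - 2))) = sym (block (cell_at s n))"
    if "lam (cell_at s (n - 1)) = 0"
  proof -
    let ?s = "s + toggle (n - 1) 1 + toggle (n - 2) (?l s (n - 2))"
    have z: "?l s (n - 1) = 0" using that by (simp add: lam)
    have "run_start ?s n = n - 1"
    proof (rule run_start_eqI)
      show "?l ?s i = 1" if "n - 1 \<le> i" "i < n" for i
      proof -
        have "i = n - 1" using that by simp
        then show ?thesis by (simp add: upd z)
      qed
    qed (auto simp: upd)
    moreover have "run_end ?s n = run_end s n"
      by (rule end_cong) (auto simp: upd)
    \<comment> \<open>\<open>half\<close> puts the old value back on lamp \<open>n - 2\<close>; only
      lamp \<open>n - 1\<close> stays changed, and \<open>outside\<close> skips it.\<close>
    moreover have "outside n (run_end s n) (?s + toggle (n - 2) (?l s (n - 2))) = outside n (run_end s n) s"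
      unfolding toggle_toggle using end_ge by (intro outside_cong) (auto simp: upd)
    ultimately show ?thesis
      using run_start_self[OF z] by (simp add: lam run_sym_def)
  qed
  show "let B = block (cell_at (s + toggle n 1 + toggle (n + 1) (lam (cell_at s (n + 1)))) n)
      in \<forall>b. half (block (cell_at s n)) b = pat B ((b, lam (cell_at s (n + 1))) + off B)"
    if "lam (cell_at s n) = 0"
  proof -
    let ?s = "s + toggle n 1 + toggle (n + 1) (?l s (n + 1))"
    let ?q = "run_start s n"
    have z: "?l s n = 0" using that by (simp add: lam)
    have "run_end ?s n = n + 1"
    proof (rule run_end_eqI)
      show "?l ?s i = 1" if "n \<le> i" "i < n + 1" for i
      proof -
        have "i = n" using that by simp
        then show ?thesis by (simp add: upd z)
      qed
    qed (auto simp: upd)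
    moreover have "run_start ?s n = ?q"
      by (rule start_cong) (auto simp: upd)
    moreover have "run_sym (?q + 1) n (s + toggle (?q - 1) b) = run_pat ?q (n + 1) ?s ((b, ?l s (n + 1)) + offset ?q (n + 1))" for b
    proof -
      \<comment> \<open>The two sides can differ only at lamps \<open>?q - 1\<close>,
        \<open>n\<close> and \<open>n + 1\<close>, all skipped here.\<close>
      have "outside ?q (n + 1) (s + toggle (?q - 1) b) = outside ?q (n + 1) ?s"
        using start_le by (intro outside_cong) (auto simp: upd)
      then show ?thesis
        using run_sym_inner[of ?q "n + 1" "s + toggle (?q - 1) b"] start_le run_start(2)[of s n]
        by (simp add: upd run_pat_def)
    qed
    ultimately show ?thesis
      using run_end_self[OF z] by (simp add: lam)
  qed
qed

end

subsection \<open>Assembling the covering subshift\<close>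

definition levels :: "(lamplighter \<Rightarrow> 'c) \<Rightarrow> sea_level \<Rightarrow> int \<Rightarrow> 'c" where
  "levels y s n = y (Lamp s n)"

lemma translate_toggle: "translate n (toggle i b) = toggle (i + n) b"
  by (rule poly_mapping_eqI) (auto simp: translate.rep_eq lookup_single when_def)

lemma levels_shift: "levels (shift (Lamp s n) y) t m = levels y (s + translate n t) (m + n)"
  by (simp add: levels_def shift_def plus_lamplighter_def)

text \<open>Right translation turns toggles relative to the head into toggles at absolute positions,
  so a condition at the origin of all shifts imposes the rule everywhere.\<close>

lemma rule_at_shift:
  "rule_at \<tau> (levels (shift (Lamp s n) y)) 0 0 \<longleftrightarrow> rule_at \<tau> (levels y) s n"
proof -
  have arith: "0 - 1 + n = n - 1" "0 - 2 + n = n - 2" "1 + n = n + 1" by simp_all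
  show ?thesis
    unfolding rule_at_def left_msg_def right_msg_def levels_shift
    by (simp only: translate_simps translate_toggle add_0_left add_0_right arith add.assoc[symmetric])
qed

definition window :: "lamplighter set" where
  "window = {Lamp t m | t m. Poly_Mapping.keys t \<subseteq> {-2..1} \<and> m \<in> {-2..1}}"

lemma finite_window: "finite window"
proof -
  have eq: "window = (\<lambda>(t, m). Lamp t m) ` ({t. Poly_Mapping.keys t \<subseteq> {-2..1}} \<times> {-2..1})"
    by (auto simp: window_def)
  show ?thesis
    unfolding eq
    by (intro finite_imageI finite_cartesian_product finite_keys_subset finite_atLeastAtMost_int)
qed

lemma rule_at_window:
  assumes "\<And>h. h \<in> window \<Longrightarrow> y h = y' h"
  shows "rule_at \<tau> (levels y) 0 0 = rule_at \<tau> (levels y') 0 0"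
proof -
  define T where "T = {t :: sea_level. Poly_Mapping.keys t \<subseteq> {-2..1}}"
  have T: "0 \<in> T" "toggle 0 b \<in> T" "toggle (0 - 1) b \<in> T" "toggle (0 - 2) b \<in> T" "toggle (0 + 1) b \<in> T"
    "s \<in> T \<Longrightarrow> t \<in> T \<Longrightarrow> s + t \<in> T" for b s t
    using keys_add[of s t] by (auto simp: T_def simp del: single_one)
  have M: "0 \<in> {-2..1::int}" "0 - 1 \<in> {-2..1::int}" "0 - 2 \<in> {-2..1::int}" "0 + 1 \<in> {-2..1::int}"
    by simp_all
  have eq: "levels y t m = levels y' t m" if "t \<in> T" "m \<in> {-2..1}" for t m
    using assms that by (auto simp: levels_def window_def T_def)
  show ?thesis
    unfolding rule_at_def left_msg_def right_msg_def
    by (simp only: eq T M)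
qed

lemma induced_shift_eq:
  assumes "finite A"
  shows "induced_shift A ((\<lambda>z. z \<circ> sea_coords) ` subst_shift A \<tau>)
    = (\<lambda>y. val \<circ> y) ` {y \<in> UNIV \<rightarrow> cells A. \<forall>g. rule_at \<tau> (levels (shift g y)) 0 0}"
    (is "?L = ?R")
proof (intro equalityI subsetI)
  fix x assume "x \<in> ?R"
  then obtain y where y: "y \<in> UNIV \<rightarrow> cells A" "\<And>g. rule_at \<tau> (levels (shift g y)) 0 0" "x = val \<circ> y"
    by blast
  have "(\<lambda>h. x (sea_incl h + g)) \<in> (\<lambda>z. z \<circ> sea_coords) ` subst_shift A \<tau>" for g
  proof -
    \<comment> \<open>Shifting by \<open>g\<close> brings the coset through \<open>g\<close> to
      level \<open>0\<close>.\<close>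
    define Y where "Y = levels (shift g y)"
    have "rule_at \<tau> Y s n" for s n
      using y(2)[of "Lamp s n + g"] rule_at_shift[of \<tau> s n "shift g y"]
      by (simp add: Y_def shift_def add.assoc)
    then interpret tiling \<tau> Y by unfold_locales
    have "Y s n \<in> cells A" for s n
      using y(1) by (auto simp: Y_def levels_def shift_def)
    from hierarchy_of_tiling[OF this]
    obtain \<xi> \<pi> c where "hierarchy A \<tau> UNIV \<xi> \<pi> c" "\<And>s. \<xi> 0 (sea_coords s) = val (Y s 0)"
      by blast
    moreover have "val (Y s 0) = x (sea_incl s + g)" for s
      by (simp add: y(3) Y_def levels_def shift_def sea_incl_def)
    ultimately have "(\<lambda>h. x (sea_incl h + g)) = \<xi> 0 \<circ> sea_coords" "\<xi> 0 \<in> subst_shift A \<tau>"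
      using subst_shift_iff_hierarchy[OF assms, of "\<xi> 0"] by auto
    then show ?thesis by blast
  qed
  moreover have "x \<in> UNIV \<rightarrow> A"
    using y(1,3) by (auto simp: cells_def)
  ultimately show "x \<in> ?L"
    unfolding induced_shift_def by blast
next
  fix x assume x: "x \<in> ?L"
  have "\<exists>\<xi> \<pi> c. hierarchy A \<tau> UNIV \<xi> \<pi> c \<and> (\<forall>s. x (Lamp s n) = \<xi> 0 (outside (n + 1) (n - 1) s))" for n
  proof -
    \<comment> \<open>Level \<open>n\<close> is the coset of \<open>Lamp 0 n\<close>;
      \<open>translate (- n)\<close> recentres its lamps at the head.\<close>
    have "(\<lambda>h. x (sea_incl h + Lamp 0 n)) \<in> (\<lambda>z. z \<circ> sea_coords) ` subst_shift A \<tau>"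
      using x by (simp add: induced_shift_def)
    then obtain z where z: "z \<in> subst_shift A \<tau>" "\<And>h. x (sea_incl h + Lamp 0 n) = z (sea_coords h)"
      by (auto simp: fun_eq_iff)
    have "x (Lamp s n) = z (outside (n + 1) (n - 1) s)" for s
    proof -
      have "sea_coords (translate (- n) s) = outside (n + 1) (n - 1) s"
        by (rule poly_mapping_eqI) (simp add: sea_coords.rep_eq lookup_outside translate.rep_eq algebra_simps)
      then show ?thesis
        using z(2)[of "translate (- n) s"] by (simp add: sea_incl_def plus_lamplighter_def translate_simps)
    qed
    then show ?thesis
      using z(1) subst_shift_iff_hierarchy[OF assms] by metis
  qed
  then obtain \<xi> \<pi> c where h: "\<And>n. hierarchy A \<tau> UNIV (\<xi> n) (\<pi> n) (c n)"
      "\<And>s n. x (Lamp s n) = \<xi> n 0 (outside (n + 1) (n - 1) s)"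
    by metis
  interpret level_hierarchies A \<tau> \<xi> \<pi> c
    by unfold_locales (rule h)
  define y where "y g = cell_at (lamps g) (pos g)" for g
  have levels_y: "levels y = cell_at"
    by (simp add: levels_def y_def fun_eq_iff)
  have "rule_at \<tau> (levels (shift g y)) 0 0" for g
    using rule_at_shift[of \<tau> "lamps g" "pos g" y] rule_at_cell_at by (simp add: levels_y)
  moreover have "x = val \<circ> y"
  proof
    fix g
    show "x g = (val \<circ> y) g"
      using h(2)[of "lamps g" "pos g"] by (simp add: y_def cell_at_def Let_def run_sym_def)
  qed
  ultimately show "x \<in> ?R"
    using cell_at_in_cells by (auto simp: y_def)
qed

theorem theorem6:
  fixes A :: "'a set" and X :: "(sea_level \<Rightarrow> 'a) set"
  assumes "is_substitutional_sea A X"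
  shows "is_sofic A (induced_shift A X)"
proof -
  obtain \<tau> where A: "finite A"
    and X: "X = (\<lambda>z. z \<circ> sea_coords) ` subst_shift A \<tau>"
    using assms unfolding is_substitutional_sea_def is_substitutional_def by blast
  show ?thesis
    unfolding X induced_shift_eq[OF A]
  proof (rule is_sofic_local_rule[OF finite_cells[OF A] finite_window])
    show "rule_at \<tau> (levels y) 0 0 = rule_at \<tau> (levels y') 0 0"
      if "\<And>h. h \<in> window \<Longrightarrow> y h = y' h" for y y' :: "lamplighter \<Rightarrow> 'a cell"
      using that by (rule rule_at_window)
  qed (auto simp: cells_def)
qed

end
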